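(* Let $r\ge1$ be an integer and $\chi_1,\ldots,\chi_r$ be Dirichlet characters of arbitrary (possibly different) moduli. Then the multiple Dirichlet $L$-function $$L_r(s_1,\ldots,s_r;\ \chi_1,\ldots,\chi_r) := \sum_{n_1>\cdots>n_r>0}\frac{\chi_1(n_1)\cdots\chi_r(n_r)}{n_1^{s_1}\cdots n_r^{s_r}},$$ defined on $\{(s_1,\ldots,s_r)\in\mathbb{C}^r : \Re(s_1+\cdots+s_i)>i \text{ for all } 1\le i\le r\}$, extends to a meromorphic function on $\mathbb{C}^r$ which is holomorphic outside the hyperplanes $$s_1=1;\qquad s_1+\cdots+s_i=n \text{ for all } n\in\mathbb{Z}_{\le i},\ 2\le i\le r,$$ and has at most simple poles along these hyperplanes.
   Context: $\mathbb{Z}_{\le i}$ denotes the set of integers less than or equal to $i$. *)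

theory Defs
  imports "HOL-Analysis.Analysis"
begin

definition dirichlet_character :: "nat \<Rightarrow> (nat \<Rightarrow> complex) \<Rightarrow> bool" where
  "dirichlet_character q chi \<longleftrightarrow>
     q > 0 \<and>
     (\<forall>m n. chi (m * n) = chi m * chi n) \<and>
     (\<forall>n. chi (n + q) = chi n) \<and>
     (\<forall>n. chi n \<noteq> 0 \<longleftrightarrow> coprime n q)"

text \<open>
  The space of \<open>r\<close> complex variables is \<open>complex ^ 'r\<close>, where \<open>'r\<close> is an arbitrary finite
  linearly ordered type with \<open>r = CARD('r)\<close> elements; its elements, in increasing order, stand
  for the indices \<open>1, \<dots>, r\<close>, and \<open>position\<close> recovers the number of an index.
\<close>

definition position :: "'r::{finite,linorder} \<Rightarrow> nat" where
  "position i = card {..i}"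

definition partial_sum :: "complex ^ 'r::{finite,linorder} \<Rightarrow> 'r \<Rightarrow> complex" where
  "partial_sum s i = (\<Sum>j\<in>{..i}. s $ j)"

definition holomorphic_several :: "(complex ^ 'r::finite \<Rightarrow> complex) \<Rightarrow> (complex ^ 'r) set \<Rightarrow> bool" where
  "holomorphic_several f U \<longleftrightarrow>
     open U \<and>
     (\<forall>a\<in>U. \<exists>D. (f has_derivative D) (at a) \<and> (\<forall>c v. D (c *s v) = c * D v))"

text \<open>
  Locally a quotient of holomorphic functions whose denominator does not vanish identically.
  The values of \<open>F\<close> at the zeros of the denominator are irrelevant.
\<close>

definition meromorphic_several :: "(complex ^ 'r::finite \<Rightarrow> complex) \<Rightarrow> (complex ^ 'r) set \<Rightarrow> bool" where
  "meromorphic_several F U \<longleftrightarrow>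
     open U \<and>
     (\<forall>a\<in>U. \<exists>V g h. a \<in> V \<and> V \<subseteq> U \<and> connected V \<and>
        holomorphic_several g V \<and> holomorphic_several h V \<and>
        (\<exists>z\<in>V. h z \<noteq> 0) \<and>
        (\<forall>z\<in>V. h z \<noteq> 0 \<longrightarrow> F z = g z / h z))"

text \<open>
  A family of hyperplanes is given by a set \<open>\<Lambda>\<close> of affine linear forms, one for each hyperplane
  (their zero sets).  Having at most simple poles along these hyperplanes means that near every
  point \<open>a\<close>, also where several of them meet, the product of \<open>F\<close> with the forms vanishing at \<open>a\<close>,
  each taken once, extends holomorphically.
\<close>

definition off_hyperplanes :: "(complex ^ 'r::finite \<Rightarrow> complex) set \<Rightarrow> (complex ^ 'r) set" where
  "off_hyperplanes \<Lambda> = {s. \<forall>l\<in>\<Lambda>. l s \<noteq> 0}"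

definition at_most_simple_poles_along ::
    "(complex ^ 'r::finite \<Rightarrow> complex) \<Rightarrow> (complex ^ 'r \<Rightarrow> complex) set \<Rightarrow> bool" where
  "at_most_simple_poles_along F \<Lambda> \<longleftrightarrow>
     (\<forall>a. finite {l\<in>\<Lambda>. l a = 0} \<and>
        (\<exists>V g. a \<in> V \<and> holomorphic_several g V \<and>
           (\<forall>s \<in> V \<inter> off_hyperplanes \<Lambda>. F s * (\<Prod>l | l \<in> \<Lambda> \<and> l a = 0. l s) = g s)))"

definition decreasing_tuples :: "('r::{finite,linorder} \<Rightarrow> nat) set" where
  "decreasing_tuples = {n. (\<forall>i. n i > 0) \<and> (\<forall>i j. i < j \<longrightarrow> n i > n j)}"

definition L_term ::
    "('r::{finite,linorder} \<Rightarrow> nat \<Rightarrow> complex) \<Rightarrow> complex ^ 'r::{finite,linorder} \<Rightarrow> ('r \<Rightarrow> nat) \<Rightarrow> complex" where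
  "L_term chi s n = (\<Prod>i\<in>UNIV. chi i (n i)) / (\<Prod>i\<in>UNIV. of_nat (n i) powr (s $ i))"

definition multiple_L ::
    "('r::{finite,linorder} \<Rightarrow> nat \<Rightarrow> complex) \<Rightarrow> complex ^ 'r::{finite,linorder} \<Rightarrow> complex" where
  "multiple_L chi s = (\<Sum>\<^sub>\<infinity>n\<in>decreasing_tuples. L_term chi s n)"

definition L_domain :: "(complex ^ 'r::{finite,linorder}) set" where
  "L_domain = {s. \<forall>i. Re (partial_sum s i) > real (position i)}"

definition polar_forms :: "(complex ^ 'r::{finite,linorder} \<Rightarrow> complex) set" where
  "polar_forms =
     {(\<lambda>s. partial_sum s i - of_int n) | i (n::int).
        (position i = 1 \<and> n = 1) \<or> (position i \<ge> 2 \<and> n \<le> int (position i))}"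

end

theory Submission
  imports Defs "HOL-Complex_Analysis.Conformal_Mappings"
begin

text \<open>
  The idea is to sum by parts in the largest index. For periodic \<open>f\<close> and \<open>z = 1 - w\<close>, a discrete
  Euler--Maclaurin formula with periodic coefficients \<open>\<phi>\<^sub>k\<close> makes the differences of
  \<open>\<Sum>k\<le>K. \<phi>\<^sub>k(n) (d/dn)\<^sup>k n\<^sup>z\<close> equal to \<open>z f(n) n\<^sup>-\<^sup>w\<close> up to an error of order
  \<open>n\<^sup>-\<^sup>w\<^sup>-\<^sup>K\<close>. Abel summation then writes \<open>(1 - w)\<close> times the series in \<open>r\<close> variables, with
  leading exponent \<open>w = s\<^sub>1 - c\<close>, as a combination of series in \<open>r - 1\<close> variables with leading
  exponents \<open>s\<^sub>1 + s\<^sub>2 - c - 1 + k\<close> and of remainders that converge on a half space growing with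
  \<open>K\<close>. Each such step introduces the single new polar hyperplane \<open>w = 1\<close>, and the
  hyperplanes of the shorter series involve only later partial sums, so all poles stay simple. The
  continuations to the growing half spaces agree by the identity theorem on complex lines in the
  direction of the first coordinate, along which every partial sum moves with speed one.
\<close>

text \<open>The products \<open>\<phi> k n * chi j n\<close> are not characters, so the induction
  runs over a class closed under the step: series over a tail of the index set whose outermost
  coefficient is any sequence of a fixed common period \<open>q\<close>, and whose outermost
  exponent is a partial sum minus an integer \<open>c\<close>. Per step \<open>c\<close> grows by at
  most one, as does the position of the index. Starting from \<open>c = 0\<close>, the hyperplane
  \<open>partial_sum s i = c + 1\<close> therefore always has \<open>c + 1\<close> at most
  \<open>position i\<close>, which is the origin of the bound on the polar integers; the first index
  meets only \<open>c = 0\<close>. The order \<open>K\<close> must be fixed before the expansion, so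
  one pass reaches only a half space. These half spaces are cut out by partial sums because
  convergence is governed by partial sums. Multiplying by 1 - w from the outset keeps the
  coefficients polynomial in w, so that each step divides exactly once.\<close>

section \<open>Holomorphic functions of several variables\<close>

text \<open>Complex differentiability at one point, split off from
  \<open>holomorphic_several\<close> so that the closure rules need no open set.\<close>

definition cdiff :: "(complex ^ 'r::finite \<Rightarrow> complex) \<Rightarrow> complex ^ 'r \<Rightarrow> bool" where
  "cdiff f a \<longleftrightarrow> (\<exists>D. (f has_derivative D) (at a) \<and> (\<forall>c v. D (c *s v) = c * D v))"

lemma holomorphic_several_iff: "holomorphic_several f U \<longleftrightarrow> open U \<and> (\<forall>a\<in>U. cdiff f a)"
  by (simp add: holomorphic_several_def cdiff_def)

lemma cdiff_const [intro]: "cdiff (\<lambda>_. c) a"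
  unfolding cdiff_def by (intro exI[of _ "\<lambda>_. 0"]) auto

lemma cdiff_component [intro]: "cdiff (\<lambda>s. s $ i) a"
  unfolding cdiff_def by (intro exI[of _ "\<lambda>s. s $ i"]) (auto intro!: bounded_linear_imp_has_derivative bounded_linear_vec_nth)

lemma cdiff_add [intro]:
  assumes "cdiff f a" "cdiff g a"
  shows "cdiff (\<lambda>s. f s + g s) a"
proof -
  obtain D E where "(f has_derivative D) (at a)" "\<forall>c v. D (c *s v) = c * D v"
    "(g has_derivative E) (at a)" "\<forall>c v. E (c *s v) = c * E v"
    using assms by (auto simp: cdiff_def)
  then show ?thesis
    unfolding cdiff_def
    by (intro exI[of _ "\<lambda>v. D v + E v"]) (auto intro!: derivative_eq_intros simp: algebra_simps)
qed

lemma cdiff_mult [intro]: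
  assumes "cdiff f a" "cdiff g a"
  shows "cdiff (\<lambda>s. f s * g s) a"
proof -
  obtain D E where "(f has_derivative D) (at a)" "\<forall>c v. D (c *s v) = c * D v"
    "(g has_derivative E) (at a)" "\<forall>c v. E (c *s v) = c * E v"
    using assms by (auto simp: cdiff_def)
  then show ?thesis
    unfolding cdiff_def
    by (intro exI[of _ "\<lambda>v. f a * E v + D v * g a"])
      (auto intro!: derivative_eq_intros simp: algebra_simps)
qed

lemma cdiff_compose:
  assumes "cdiff f a" "(\<phi> has_field_derivative c) (at (f a))"
  shows "cdiff (\<lambda>s. \<phi> (f s)) a"
proof -
  obtain D where D: "(f has_derivative D) (at a)" "\<forall>c v. D (c *s v) = c * D v"
    using assms by (auto simp: cdiff_def)
  have "((\<lambda>s. \<phi> (f s)) has_derivative (\<lambda>v. c * D v)) (at a)"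
    using has_derivative_compose[OF D(1), of \<phi> "(*) c"] assms(2)
    by (simp add: has_field_derivative_def)
  with D(2) show ?thesis
    unfolding cdiff_def by (intro exI[of _ "\<lambda>v. c * D v"]) auto
qed

lemma cdiff_uminus [intro]: "cdiff f a \<Longrightarrow> cdiff (\<lambda>s. - f s) a"
  using cdiff_mult[OF cdiff_const[of "-1"], of f a] by simp

lemma cdiff_diff [intro]: "cdiff f a \<Longrightarrow> cdiff g a \<Longrightarrow> cdiff (\<lambda>s. f s - g s) a"
  using cdiff_add[of f a "\<lambda>s. - g s"] by (auto intro: cdiff_uminus)

lemma cdiff_sum: "(\<And>i. i \<in> I \<Longrightarrow> cdiff (f i) a) \<Longrightarrow> cdiff (\<lambda>s. \<Sum>i\<in>I. f i s) a"
  by (induction I rule: infinite_finite_induct) auto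

lemma cdiff_prod: "(\<And>i. i \<in> I \<Longrightarrow> cdiff (f i) a) \<Longrightarrow> cdiff (\<lambda>s. \<Prod>i\<in>I. f i s) a"
  by (induction I rule: infinite_finite_induct) auto

lemma cdiff_inverse: "cdiff f a \<Longrightarrow> f a \<noteq> 0 \<Longrightarrow> cdiff (\<lambda>s. inverse (f s)) a"
  by (erule cdiff_compose) (auto intro!: derivative_eq_intros)

lemma cdiff_nat_powr: "cdiff f a \<Longrightarrow> cdiff (\<lambda>s. of_nat n powr f s) a"
proof (cases "n = 0")
  case False
  then show "cdiff f a \<Longrightarrow> ?thesis"
    by (elim cdiff_compose) (auto intro!: derivative_eq_intros)
qed auto

lemma cdiff_eventually_cong:
  assumes "cdiff f a" "open U" "a \<in> U" "\<And>s. s \<in> U \<Longrightarrow> f s = g s"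
  shows "cdiff g a"
  using assms has_derivative_transform_within_open unfolding cdiff_def by blast

lemma cdiff_imp_isCont: "cdiff f a \<Longrightarrow> isCont f a"
  unfolding cdiff_def using has_derivative_continuous by blast

lemma norm_vector_smult: "norm (c *s (v :: complex ^ 'r::finite)) = norm c * norm v"
proof -
  have "(\<Sum>i\<in>UNIV. (norm (c * v $ i))\<^sup>2) = (norm c)\<^sup>2 * (\<Sum>i\<in>UNIV. (norm (v $ i))\<^sup>2)"
    by (simp add: norm_mult power_mult_distrib sum_distrib_left)
  then show ?thesis by (simp add: norm_vec_def L2_set_def real_sqrt_mult)
qed

section \<open>Restriction to complex lines, and locally uniform limits\<close>

lemma has_derivative_line:
  "((\<lambda>t. x + t *s v) has_derivative (\<lambda>h. h *s v)) (at t)" for v :: "complex ^ 'r::finite"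
proof -
  have "linear (\<lambda>t. t *s v)"
    by (rule linearI) (auto simp: vec_eq_iff algebra_simps)
  then have "bounded_linear (\<lambda>t. t *s v)"
    by (simp add: linear_conv_bounded_linear)
  then show ?thesis
    by (auto intro!: derivative_eq_intros bounded_linear_imp_has_derivative)
qed

lemma has_field_derivative_line:
  fixes x v :: "complex ^ 'r::finite"
  assumes "(f has_derivative D) (at (x + t *s v))" "\<And>c. D (c *s v) = c * D v"
  shows "((\<lambda>t. f (x + t *s v)) has_field_derivative D v) (at t)"
proof -
  have "(\<lambda>h. D (h *s v)) = (*) (D v)" by (auto simp: assms(2))
  then show ?thesis
    using has_derivative_compose[OF has_derivative_line assms(1)]
    by (simp add: has_field_derivative_def)
qed

lemma cdiff_line:
  assumes "cdiff f (x + t *s v)"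
  shows "(\<lambda>t. f (x + t *s v)) field_differentiable (at t)"
  using assms has_field_derivative_line unfolding cdiff_def field_differentiable_def by blast

text \<open>Cauchy's inequality on the complex line through \<open>x\<close> in direction \<open>v\<close>.\<close>

lemma cdiff_derivative_bound:
  fixes f :: "complex ^ 'r::finite \<Rightarrow> complex"
  assumes cd: "\<And>y. y \<in> cball x \<rho> \<Longrightarrow> cdiff f y" and bd: "\<And>y. y \<in> cball x \<rho> \<Longrightarrow> norm (f y) \<le> B"
    and "\<rho> > 0" and D: "(f has_derivative D) (at x)" "\<And>c v. D (c *s v) = c * D v"
  shows "norm (D v) \<le> B / \<rho> * norm v"
proof (cases "v = 0")
  case True
  then show ?thesis using D(2)[of 0 v] by simp
next
  case False
  define r where "r = \<rho> / norm v"
  have r: "r > 0" using False assms by (simp add: r_def)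
  have in_ball: "x + t *s v \<in> cball x \<rho>" if "norm t \<le> r" for t
    using that False by (simp add: dist_norm norm_vector_smult r_def field_simps)
  have "norm ((deriv ^^ 1) (\<lambda>t. f (x + t *s v)) 0) \<le> fact 1 * B / r ^ 1"
  proof (rule Cauchy_inequality)
    have "(\<lambda>t. f (x + t *s v)) holomorphic_on cball 0 r"
      unfolding holomorphic_on_def
      using cdiff_line[OF cd[OF in_ball]] field_differentiable_at_within by fastforce
    then show "(\<lambda>t. f (x + t *s v)) holomorphic_on ball 0 r"
      "continuous_on (cball 0 r) (\<lambda>t. f (x + t *s v))"
      using holomorphic_on_subset ball_subset_cball holomorphic_on_imp_continuous_on by blast+
  qed (use r in_ball bd in auto)
  moreover have "((\<lambda>t. f (x + t *s v)) has_field_derivative D v) (at 0)"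
    using has_field_derivative_line[of f D x 0 v] D by simp
  then have "deriv (\<lambda>t. f (x + t *s v)) 0 = D v" by (rule DERIV_imp_deriv)
  ultimately show ?thesis by (simp add: r_def field_simps)
qed

text \<open>Weierstrass's convergence theorem. Cauchy's inequality turns uniform closeness of the
  functions into closeness of their derivatives on a smaller ball, so the derivatives converge
  uniformly there; complex linearity passes to the limit.\<close>

lemma cdiff_uniform_limit:
  fixes f :: "nat \<Rightarrow> complex ^ 'r::finite \<Rightarrow> complex"
  assumes U: "open U" "a \<in> U" and cd: "\<And>n s. s \<in> U \<Longrightarrow> cdiff (f n) s"
    and lim: "uniform_limit U f F sequentially"
  shows "cdiff F a"
proof -
  obtain \<delta> where \<delta>: "\<delta> > 0" "cball a \<delta> \<subseteq> U"
    using U open_contains_cball by blast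
  \<comment> \<open>Balls of radius \<open>\<rho>\<close> around points of
    \<open>ball a \<rho>\<close> stay in \<open>U\<close>, so Cauchy's inequality applies at all
    these points with the same radius.\<close>
  define \<rho> where "\<rho> = \<delta> / 2"
  have \<rho>: "\<rho> > 0" using \<delta> by (simp add: \<rho>_def)
  have sub: "cball x \<rho> \<subseteq> U" if "x \<in> ball a \<rho>" for x
  proof -
    have "cball x \<rho> \<subseteq> cball a \<delta>"
    proof
      fix y assume "y \<in> cball x \<rho>"
      then show "y \<in> cball a \<delta>"
        using that dist_triangle[of a y x] by (simp add: \<rho>_def)
    qed
    with \<delta> show ?thesis by blast
  qed
  have xU: "x \<in> U" if "x \<in> ball a \<rho>" for x
    using sub[OF that] \<rho> by auto
  have "\<forall>n x. \<exists>D. x \<in> U \<longrightarrow> (f n has_derivative D) (at x) \<and> (\<forall>c v. D (c *s v) = c * D v)"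
    using cd unfolding cdiff_def by blast
  then obtain D where D: "\<And>n x. x \<in> U \<Longrightarrow> (f n has_derivative D n x) (at x)"
    "\<And>n x c v. x \<in> U \<Longrightarrow> D n x (c *s v) = c * D n x v"
    by metis
  have close: "\<exists>N. \<forall>n\<ge>N. \<forall>m\<ge>N. \<forall>x\<in>ball a \<rho>. \<forall>v. norm (D n x v - D m x v) \<le> e * norm v" if "e > 0" for e
  proof -
    \<comment> \<open>Two such errors bound \<open>f n y - f m y\<close> by
      \<open>e * \<rho>\<close>, and Cauchy's inequality divides by \<open>\<rho>\<close>.\<close>
    have "e * \<rho> / 2 > 0" using that \<rho> by simp
    then obtain N where N: "\<And>n y. n \<ge> N \<Longrightarrow> y \<in> U \<Longrightarrow> dist (f n y) (F y) < e * \<rho> / 2"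
      using lim unfolding uniform_limit_iff eventually_sequentially by metis
    have "norm (D n x v - D m x v) \<le> e * norm v" if "n \<ge> N" "m \<ge> N" and x: "x \<in> ball a \<rho>" for n m x v
    proof -
      have "norm (D n x v - D m x v) \<le> (e * \<rho>) / \<rho> * norm v"
      proof (rule cdiff_derivative_bound[where f = "\<lambda>y. f n y - f m y" and D = "\<lambda>v. D n x v - D m x v"])
        show "cdiff (\<lambda>y. f n y - f m y) y" if "y \<in> cball x \<rho>" for y
          using sub[OF x] that cd by blast
        show "norm (f n y - f m y) \<le> e * \<rho>" if "y \<in> cball x \<rho>" for y
        proof -
          have "y \<in> U" using sub[OF x] that by blast
          then show ?thesis
            using N[OF \<open>n \<ge> N\<close>, of y] N[OF \<open>m \<ge> N\<close>, of y] dist_triangle2[of "f n y" "f m y" "F y"]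
            by (simp add: dist_norm)
        qed
        show "((\<lambda>y. f n y - f m y) has_derivative (\<lambda>v. D n x v - D m x v)) (at x)"
          using D(1)[OF xU[OF x]] by (intro has_derivative_diff)
      qed (use \<rho> D(2)[OF xU[OF x]] in \<open>auto simp: algebra_simps\<close>)
      then show ?thesis using \<rho> by simp
    qed
    then show ?thesis by blast
  qed
  define E where "E x v = lim (\<lambda>n. D n x v)" for x v
  have E: "(\<lambda>n. D n x v) \<longlonglongrightarrow> E x v" if x: "x \<in> ball a \<rho>" for x v
  proof -
    have "Cauchy (\<lambda>n. D n x v)"
    proof (rule metric_CauchyI)
      fix e :: real assume "e > 0"
      then have "e / (norm v + 1) > 0" by (simp add: add_nonneg_pos)
      then obtain N where N: "\<forall>n\<ge>N. \<forall>m\<ge>N. \<forall>x\<in>ball a \<rho>. \<forall>v'. norm (D n x v' - D m x v') \<le> e / (norm v + 1) * norm v'"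
        using close by blast
      have "e / (norm v + 1) * norm v < e"
        using \<open>e > 0\<close> add_nonneg_pos[OF norm_ge_zero[of v] zero_less_one] by (simp add: field_simps)
      then show "\<exists>M. \<forall>m\<ge>M. \<forall>n\<ge>M. dist (D m x v) (D n x v) < e"
        using N x unfolding dist_norm by (meson order_le_less_trans)
    qed
    then show ?thesis unfolding E_def by (simp add: Cauchy_convergent convergent_LIMSEQ_iff[symmetric])
  qed
  have "\<exists>g. \<forall>x\<in>ball a \<rho>. (\<lambda>n. f n x) \<longlonglongrightarrow> g x \<and> (g has_derivative E x) (at x within ball a \<rho>)"
  proof (rule has_derivative_sequence)
    show "(f n has_derivative D n x) (at x within ball a \<rho>)" if "x \<in> ball a \<rho>" for n x
      using D(1)[OF xU[OF that]] by (rule has_derivative_at_withinI)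
    show "\<forall>\<^sub>F n in sequentially. \<forall>x\<in>ball a \<rho>. \<forall>h. norm (D n x h - E x h) \<le> e * norm h" if e: "e > 0" for e
    proof -
      obtain N where N: "\<forall>n\<ge>N. \<forall>m\<ge>N. \<forall>x\<in>ball a \<rho>. \<forall>v. norm (D n x v - D m x v) \<le> e * norm v"
        using close[OF e] by blast
      have "norm (D n x h - E x h) \<le> e * norm h" if "n \<ge> N" "x \<in> ball a \<rho>" for n x h
      proof (rule Lim_bounded)
        show "(\<lambda>m. norm (D n x h - D m x h)) \<longlonglongrightarrow> norm (D n x h - E x h)"
          by (intro tendsto_intros E that)
        show "\<forall>m\<ge>N. norm (D n x h - D m x h) \<le> e * norm h" using N that by blast
      qed
      then show ?thesis unfolding eventually_sequentially by blast
    qed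
    show "(\<lambda>n. f n a) \<longlonglongrightarrow> F a" using lim U(2) by (rule tendsto_uniform_limitI)
  qed (use \<rho> in auto)
  then obtain g where g: "\<And>x. x \<in> ball a \<rho> \<Longrightarrow> (\<lambda>n. f n x) \<longlonglongrightarrow> g x"
    "\<And>x. x \<in> ball a \<rho> \<Longrightarrow> (g has_derivative E x) (at x within ball a \<rho>)" by blast
  have gF: "g x = F x" if "x \<in> ball a \<rho>" for x
    using g(1)[OF that] tendsto_uniform_limitI[OF lim xU[OF that]] LIMSEQ_unique by blast
  have a: "a \<in> ball a \<rho>" using \<rho> by simp
  have "(g has_derivative E a) (at a)"
    using g(2)[OF a] at_within_open[OF a] by simp
  moreover have "E a (c *s v) = c * E a v" for c v
  proof (rule LIMSEQ_unique[OF E[OF a]])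
    show "(\<lambda>n. D n a (c *s v)) \<longlonglongrightarrow> c * E a v"
      using tendsto_mult_left[OF E[OF a, of v], of c] U by (simp add: D)
  qed
  ultimately have "cdiff g a" unfolding cdiff_def by blast
  then show ?thesis
    by (rule cdiff_eventually_cong[OF _ open_ball a]) (use gF in auto)
qed

lemma cdiff_suminf:
  fixes f :: "nat \<Rightarrow> complex ^ 'r::finite \<Rightarrow> complex"
  assumes U: "open U" "a \<in> U" and cd: "\<And>n s. s \<in> U \<Longrightarrow> cdiff (f n) s"
    and M: "\<And>n s. s \<in> U \<Longrightarrow> norm (f n s) \<le> M n" "summable M"
  shows "cdiff (\<lambda>s. \<Sum>n. f n s) a"
  by (rule cdiff_uniform_limit[OF U _ Weierstrass_m_test[OF M]]) (auto intro: cdiff_sum cd)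

section \<open>A discrete Euler--Maclaurin formula\<close>

definition periodic :: "nat \<Rightarrow> (nat \<Rightarrow> complex) \<Rightarrow> bool" where
  "periodic q f \<longleftrightarrow> (\<forall>n. f (n + q) = f n)"

lemma periodic_bounded:
  assumes "q > 0" "periodic q f"
  obtains M where "M \<ge> 0" "\<And>n. norm (f n) \<le> M"
proof -
  have mod: "f n = f (n mod q)" for n
  proof -
    have "f (m + k * q) = f m" for m k
      using assms(2) by (induction k) (auto simp: periodic_def algebra_simps, metis add.assoc add.commute)
    from this[of "n mod q" "n div q"] show ?thesis by simp
  qed
  have "norm (f n) \<le> (\<Sum>k<q. norm (f k))" for n
    unfolding mod[of n] using assms(1) by (intro member_le_sum) auto
  then show ?thesis by (intro that[of "\<Sum>k<q. norm (f k)"]) (auto intro: sum_nonneg)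
qed

text \<open>The partial sums of \<open>f\<close> are an antidifference; a vanishing sum over one
  period makes them periodic.\<close>

lemma periodic_antidifference:
  assumes "periodic q f" "(\<Sum>n<q. f n) = 0"
  shows "\<exists>\<phi>. periodic q \<phi> \<and> (\<forall>n. \<phi> (Suc n) - \<phi> n = f n)"
proof -
  define \<phi> where "\<phi> n = (\<Sum>k<n. f k)" for n
  have "\<phi> (n + q) = \<phi> n" for n
    using assms by (induction n) (auto simp: \<phi>_def periodic_def)
  then show ?thesis by (intro exI[of _ \<phi>]) (auto simp: periodic_def \<phi>_def)
qed

text \<open>The equation of order \<open>m\<close> says that, after Taylor expansion about
  \<open>n\<close>, the derivatives of order \<open>m\<close> cancel except for \<open>f\<close> at
  order 1. It has a periodic solution only if its right side has mean zero over a period; the last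
  conjunct carries this condition for the next order, and the free additive constant of each
  coefficient is spent on it. For \<open>f = 1\<close> and \<open>q = 1\<close> the coefficients are
  the Bernoulli numbers divided by k!, with generating function t / (exp t - 1).\<close>

lemma periodic_Bernoulli_exists:
  assumes q: "q > 0" and f: "periodic q f"
  shows "\<exists>\<phi> :: nat \<Rightarrow> nat \<Rightarrow> complex.
    (\<forall>m\<le>K. periodic q (\<phi> m) \<and>
      (\<forall>n. \<phi> m (Suc n) - \<phi> m n = (if m = 1 then f n else 0) - (\<Sum>k<m. \<phi> k (Suc n) / fact (m - k)))) \<and>
    (\<Sum>n<q. (if K = 0 then f n else 0) - (\<Sum>k<Suc K. \<phi> k (Suc n) / fact (Suc K - k))) = 0"
proof (induction K)
  case 0
  \<comment> \<open>Order 0 forces a constant, and the mean condition of order 1 forces it to be the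
    mean of \<open>f\<close>.\<close>
  show ?case
    using q by (intro exI[of _ "\<lambda>_ _. (\<Sum>n<q. f n) / of_nat q"]) (auto simp: periodic_def sum_subtractf)
next
  case (Suc K)
  then obtain \<phi> :: "nat \<Rightarrow> nat \<Rightarrow> complex" where per: "\<And>m. m \<le> K \<Longrightarrow> periodic q (\<phi> m)"
    and step: "\<And>m n. m \<le> K \<Longrightarrow> \<phi> m (Suc n) - \<phi> m n = (if m = 1 then f n else 0) - (\<Sum>k<m. \<phi> k (Suc n) / fact (m - k))"
    and mean: "(\<Sum>n<q. (if K = 0 then f n else 0) - (\<Sum>k<Suc K. \<phi> k (Suc n) / fact (Suc K - k))) = 0"
    by blast
  have "periodic q (\<lambda>n. (if K = 0 then f n else 0) - (\<Sum>k<Suc K. \<phi> k (Suc n) / fact (Suc K - k)))"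
    using per f unfolding periodic_def by (auto intro!: sum.cong simp flip: add_Suc)
  then obtain \<psi> where \<psi>: "periodic q \<psi>"
    "\<And>n. \<psi> (Suc n) - \<psi> n = (if K = 0 then f n else 0) - (\<Sum>k<Suc K. \<phi> k (Suc n) / fact (Suc K - k))"
    using periodic_antidifference mean by blast
  \<comment> \<open>In the equation of order \<open>K + 2\<close> the new coefficient enters with
    weight 1 / 1!, so adding this constant makes the right side sum to zero over a period.\<close>
  define c where "c = - (\<Sum>n<q. (\<Sum>k<Suc K. \<phi> k (Suc n) / fact (Suc (Suc K) - k)) + \<psi> (Suc n)) / of_nat q"
  define \<phi>' where "\<phi>' = \<phi>(Suc K := \<lambda>n. \<psi> n + c)"
  have \<phi>': "\<phi>' k = \<phi> k" if "k \<le> K" for k using that by (simp add: \<phi>'_def)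
  have \<phi>'K: "\<phi>' (Suc K) n = \<psi> n + c" for n by (simp add: \<phi>'_def)
  have sums: "(\<Sum>k<m. \<phi>' k (Suc n) / fact (j - k)) = (\<Sum>k<m. \<phi> k (Suc n) / fact (j - k))" if "m \<le> Suc K" for m n j
    using that by (intro sum.cong) (auto simp: \<phi>')
  show ?case
  proof (intro exI[of _ \<phi>'] conjI allI impI)
    fix m assume m: "m \<le> Suc K"
    show "periodic q (\<phi>' m)"
      using m per \<psi>(1) by (cases "m = Suc K") (auto simp: \<phi>' \<phi>'K periodic_def)
    show "\<phi>' m (Suc n) - \<phi>' m n = (if m = 1 then f n else 0) - (\<Sum>k<m. \<phi>' k (Suc n) / fact (m - k))" for n
    proof (cases "m = Suc K")
      case True
      then show ?thesis using \<psi>(2)[of n] sums[OF m, where j = "Suc K"] by (simp add: \<phi>'K del: sum.lessThan_Suc)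
    next
      case False
      then have "m \<le> K" using m by simp
      then show ?thesis using step[OF \<open>m \<le> K\<close>] sums[OF m] by (simp add: \<phi>')
    qed
  next
    have "(\<Sum>n<q. (\<Sum>k<Suc (Suc K). \<phi>' k (Suc n) / fact (Suc (Suc K) - k)))
        = (\<Sum>n<q. ((\<Sum>k<Suc K. \<phi> k (Suc n) / fact (Suc (Suc K) - k)) + \<psi> (Suc n)) + c)"
      unfolding sum.lessThan_Suc[of _ "Suc K"] sums[OF order.refl] \<phi>'K by (simp add: add.assoc)
    also have "\<dots> = 0"
      unfolding sum.distrib[of _ "\<lambda>_. c"] using q by (simp add: c_def)
    finally show "(\<Sum>n<q. (if Suc K = 0 then f n else 0) - (\<Sum>k<Suc (Suc K). \<phi>' k (Suc n) / fact (Suc (Suc K) - k))) = 0"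
      by (simp add: sum_negf del: sum.lessThan_Suc)
  qed
qed

section \<open>Error of the Euler--Maclaurin approximation for complex powers\<close>

definition falling :: "nat \<Rightarrow> complex \<Rightarrow> complex" where
  "falling k z = (\<Prod>l<k. z - of_nat l)"

definition powr_deriv :: "complex \<Rightarrow> nat \<Rightarrow> complex \<Rightarrow> complex" where
  "powr_deriv z k x = falling k z * x powr (z - of_nat k)"

text \<open>
  With \<open>z = 1 - w\<close>, the sequence \<open>EM_sum \<phi> K z\<close> is \<open>z\<close> times an approximate antidifference of
  \<open>f n * n powr (-w)\<close>; the factor \<open>z\<close> removes the pole at \<open>w = 1\<close>.
\<close>

definition EM_sum :: "(nat \<Rightarrow> nat \<Rightarrow> complex) \<Rightarrow> nat \<Rightarrow> complex \<Rightarrow> nat \<Rightarrow> complex" where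
  "EM_sum \<phi> K z n = (\<Sum>k\<le>K. \<phi> k n * powr_deriv z k (of_nat n))"

definition EM_error :: "(nat \<Rightarrow> complex) \<Rightarrow> (nat \<Rightarrow> nat \<Rightarrow> complex) \<Rightarrow> nat \<Rightarrow> complex \<Rightarrow> nat \<Rightarrow> complex" where
  "EM_error f \<phi> K z n = EM_sum \<phi> K z (Suc n) - EM_sum \<phi> K z n - f n * (z * of_nat n powr (z - 1))"

text \<open>The constant depends on a bound for \<open>z\<close> but not on \<open>z\<close>, so
  that the remainder series converge locally uniformly. At \<open>n = 0\<close> the right side would
  be 0, hence the start at 1.\<close>

definition EM_error_small :: "(nat \<Rightarrow> complex) \<Rightarrow> (nat \<Rightarrow> nat \<Rightarrow> complex) \<Rightarrow> nat \<Rightarrow> bool" where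
  "EM_error_small f \<phi> K \<longleftrightarrow> (\<forall>R. \<exists>C. \<forall>z n. norm z \<le> R \<longrightarrow> n \<ge> 1 \<longrightarrow>
     norm (EM_error f \<phi> K z n) \<le> C * real n powr (Re z - real (Suc K)))"

lemma norm_falling_le:
  assumes "norm z \<le> R"
  shows "norm (falling k z) \<le> (R + real k) ^ k"
proof -
  have "norm (falling k z) \<le> (\<Prod>l<k. R + real k)"
    unfolding falling_def prod_norm[symmetric]
  proof (rule prod_mono)
    fix l assume "l \<in> {..<k}"
    then show "0 \<le> norm (z - of_nat l) \<and> norm (z - of_nat l) \<le> R + real k"
      using norm_triangle_ineq4[of z "of_nat l"] assms by simp
  qed
  then show ?thesis by simp
qed

text \<open>The expansion stops at the derivative of order \<open>K\<close> whatever
  \<open>k\<close> is, so the Taylor remainder on [n, n + 1] always involves order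
  \<open>K + 1\<close>, and one bound serves all \<open>k\<close>.\<close>

lemma powr_deriv_Taylor:
  assumes n: "n \<ge> 1" and k: "k \<le> K" and R: "norm z \<le> R"
  shows "norm (powr_deriv z k (of_nat (Suc n)) - (\<Sum>l\<le>K-k. powr_deriv z (k + l) (of_nat n) / fact l))
    \<le> (R + real (Suc K)) ^ Suc K * 2 powr (R + real (Suc K)) * real n powr (Re z - real (Suc K))"
proof -
  define S where "S = closed_segment (of_nat n) (of_nat (Suc n) :: complex)"
  have S: "\<exists>t. x = of_real t \<and> real n \<le> t \<and> t \<le> 2 * real n" if "x \<in> S" for x
  proof -
    have "x \<in> of_real ` closed_segment (real n) (real (Suc n))"
      using that unfolding S_def by (metis closed_segment_of_real of_real_of_nat_eq)
    then show ?thesis using n by (auto simp: closed_segment_eq_real_ivl)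
  qed
  define B where "B = (R + real (Suc K)) ^ Suc K * 2 powr (R + real (Suc K)) * real n powr (Re z - real (Suc K))"
  have R0: "R \<ge> 0" using R norm_ge_zero order.trans by blast
  have "norm (powr_deriv z (k+0) (of_nat (Suc n)) - (\<Sum>l\<le>K-k. powr_deriv z (k + l) (of_nat n) * (of_nat (Suc n) - of_nat n) ^ l / fact l))
    \<le> B * norm (of_nat (Suc n) - of_nat n :: complex) ^ Suc (K - k) / fact (K - k)"
  proof (rule complex_Taylor[where S = S and f = "\<lambda>i. powr_deriv z (k + i)"])
    show "(powr_deriv z (k + i) has_field_derivative powr_deriv z (k + Suc i) x) (at x within S)" if "x \<in> S" for i x
    proof -
      obtain t where t: "x = of_real t" "real n \<le> t" using S[OF \<open>x \<in> S\<close>] by blast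
      then have "x \<notin> \<real>\<^sub>\<le>\<^sub>0" using n by simp
      then show ?thesis
        unfolding powr_deriv_def falling_def
        by (auto intro!: derivative_eq_intros simp: algebra_simps diff_diff_eq2)
    qed
    show "norm (powr_deriv z (k + Suc (K - k)) x) \<le> B" if "x \<in> S" for x
    proof -
      obtain t where t: "x = of_real t" "real n \<le> t" "t \<le> 2 * real n" using S[OF \<open>x \<in> S\<close>] by blast
      have t0: "t > 0" using t n by linarith
      define a where "a = Re z - real (Suc K)"
      have abs_a: "\<bar>a\<bar> \<le> R + real (Suc K)"
        using abs_Re_le_cmod[of z] R by (simp add: a_def)
      \<comment> \<open>The quotient \<open>t / real n\<close> lies in [1, 2], so passing to the
        absolute value of \<open>a\<close> covers both signs of the exponent.\<close>
      have "t powr a = (t / real n) powr a * real n powr a"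
        using t0 n by (simp add: powr_divide)
      also have "(t / real n) powr a \<le> (t / real n) powr \<bar>a\<bar>"
        using t n by (intro powr_mono) (auto simp: field_simps)
      also have "(t / real n) powr \<bar>a\<bar> \<le> 2 powr \<bar>a\<bar>"
        using t n t0 by (intro powr_mono2) (auto simp: field_simps)
      also have "2 powr \<bar>a\<bar> \<le> 2 powr (R + real (Suc K))"
        using abs_a by (intro powr_mono) auto
      finally have ta: "t powr a \<le> 2 powr (R + real (Suc K)) * real n powr a"
        by (simp add: mult_right_mono)
      have "norm (powr_deriv z (Suc K) x) = norm (falling (Suc K) z) * t powr a"
        using t0 by (simp add: powr_deriv_def norm_mult t(1) norm_powr_real_powr a_def)
      also have "\<dots> \<le> (R + real (Suc K)) ^ Suc K * (2 powr (R + real (Suc K)) * real n powr a)"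
        using R0 by (intro mult_mono norm_falling_le R ta) auto
      finally show ?thesis using k by (simp add: B_def a_def mult.assoc)
    qed
  qed (auto simp: S_def)
  also have "\<dots> \<le> B"
  proof -
    have "B \<ge> 0" using R0 by (simp add: B_def)
    then have "B * 1 \<le> B * fact (K - k)" by (intro mult_left_mono fact_ge_1)
    then show ?thesis by (simp add: divide_le_eq)
  qed
  finally show ?thesis by (simp add: B_def)
qed

text \<open>Collect the Taylor polynomials by the order \<open>m = k + l\<close> of the derivative:
  the recursion turns the coefficient of order \<open>m\<close> into \<open>\<phi> m n\<close>, plus
  \<open>f n\<close> for \<open>m = 1\<close>. These are the terms subtracted in
  \<open>EM_error\<close>, so only the Taylor remainders survive.\<close>

lemma EM_error_eq:
  assumes K: "K \<ge> 1"
    and step: "\<And>m n. m \<le> K \<Longrightarrow> \<phi> m (Suc n) - \<phi> m n = (if m = 1 then f n else 0) - (\<Sum>k<m. \<phi> k (Suc n) / fact (m - k))"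
  shows "EM_error f \<phi> K z n =
    (\<Sum>k\<le>K. \<phi> k (Suc n) * (powr_deriv z k (of_nat (Suc n)) - (\<Sum>l\<le>K-k. powr_deriv z (k + l) (of_nat n) / fact l)))"
proof -
  define P where "P k = powr_deriv z k (of_nat n)" for k
  have "(\<Sum>k\<le>K. \<phi> k (Suc n) * (\<Sum>l\<le>K-k. P (k + l) / fact l))
    = (\<Sum>k\<le>K. \<Sum>l\<le>K-k. \<phi> k (Suc n) * (P (k + l) / fact l))"
    by (simp add: sum_distrib_left)
  also have "\<dots> = (\<Sum>(k,l)\<in>{(i, j). i + j \<le> K}. \<phi> k (Suc n) * (P (k + l) / fact l))"
    by (subst sum.Sigma) (auto intro!: sum.cong)
  also have "\<dots> = (\<Sum>m\<le>K. \<Sum>k\<le>m. \<phi> k (Suc n) * (P (k + (m - k)) / fact (m - k)))"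
    by (rule sum.triangle_reindex_eq)
  also have "\<dots> = (\<Sum>m\<le>K. (\<phi> m n + (if m = 1 then f n else 0)) * P m)"
  proof (rule sum.cong)
    fix m assume "m \<in> {..K}"
    have "(\<Sum>k\<le>m. \<phi> k (Suc n) * (P (k + (m - k)) / fact (m - k))) = (\<Sum>k\<le>m. \<phi> k (Suc n) / fact (m - k)) * P m"
      unfolding sum_distrib_right by (intro sum.cong) auto
    also have "(\<Sum>k\<le>m. \<phi> k (Suc n) / fact (m - k)) = \<phi> m n + (if m = 1 then f n else 0)"
      using step[of m n] \<open>m \<in> {..K}\<close> by (simp add: lessThan_Suc_atMost[symmetric] algebra_simps)
    finally show "(\<Sum>k\<le>m. \<phi> k (Suc n) * (P (k + (m - k)) / fact (m - k))) = (\<phi> m n + (if m = 1 then f n else 0)) * P m" .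
  qed simp
  also have "\<dots> = EM_sum \<phi> K z n + (\<Sum>m\<le>K. if m = 1 then f n * P m else 0)"
    unfolding EM_sum_def P_def sum.distrib[symmetric] by (intro sum.cong) (auto simp: algebra_simps)
  also have "(\<Sum>m\<le>K. if m = 1 then f n * P m else 0) = f n * (z * of_nat n powr (z - 1))"
    using K by (simp add: P_def powr_deriv_def falling_def)
  finally show ?thesis
    unfolding EM_error_def EM_sum_def[of _ _ _ "Suc n"] P_def
    by (simp only: right_diff_distrib sum_subtractf) (simp add: diff_diff_eq)
qed

lemma Euler_Maclaurin:
  assumes q: "q > 0" and f: "periodic q f" and K: "K \<ge> 1"
  shows "\<exists>\<phi>. (\<forall>k\<le>K. periodic q (\<phi> k)) \<and> EM_error_small f \<phi> K"
proof -
  obtain \<phi> :: "nat \<Rightarrow> nat \<Rightarrow> complex" where per: "\<And>m. m \<le> K \<Longrightarrow> periodic q (\<phi> m)"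
    and step: "\<And>m n. m \<le> K \<Longrightarrow> \<phi> m (Suc n) - \<phi> m n = (if m = 1 then f n else 0) - (\<Sum>k<m. \<phi> k (Suc n) / fact (m - k))"
    using periodic_Bernoulli_exists[OF q f, of K] by blast
  have "\<forall>k. \<exists>M. k \<le> K \<longrightarrow> (\<forall>n. norm (\<phi> k n) \<le> M)"
    using periodic_bounded[OF q per] by metis
  then obtain M where M: "\<And>k n. k \<le> K \<Longrightarrow> norm (\<phi> k n) \<le> M k" by metis
  have "norm (EM_error f \<phi> K z n) \<le>
      (\<Sum>k\<le>K. M k) * ((R + real (Suc K)) ^ Suc K * 2 powr (R + real (Suc K))) * real n powr (Re z - real (Suc K))"
    if "norm z \<le> R" "n \<ge> 1" for R z n
  proof -
    define b where "b = (R + real (Suc K)) ^ Suc K * 2 powr (R + real (Suc K)) * real n powr (Re z - real (Suc K))"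
    have eq: "EM_error f \<phi> K z n = (\<Sum>k\<le>K. \<phi> k (Suc n) *
        (powr_deriv z k (of_nat (Suc n)) - (\<Sum>l\<le>K-k. powr_deriv z (k + l) (of_nat n) / fact l)))"
      by (rule EM_error_eq[OF K]) (rule step)
    have "norm (EM_error f \<phi> K z n) \<le> (\<Sum>k\<le>K. M k * b)"
      unfolding eq b_def
    proof (rule sum_norm_le)
      fix k assume "k \<in> {..K}"
      then have k: "k \<le> K" by simp
      then have "0 \<le> M k" using M norm_ge_zero order.trans by blast
      then show "norm (\<phi> k (Suc n) * (powr_deriv z k (of_nat (Suc n)) - (\<Sum>l\<le>K-k. powr_deriv z (k + l) (of_nat n) / fact l)))
        \<le> M k * ((R + real (Suc K)) ^ Suc K * 2 powr (R + real (Suc K)) * real n powr (Re z - real (Suc K)))"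
        unfolding norm_mult by (intro mult_mono powr_deriv_Taylor that k M) auto
    qed
    then show ?thesis by (simp add: b_def sum_distrib_right mult.assoc)
  qed
  then have "EM_error_small f \<phi> K" unfolding EM_error_small_def by blast
  then show ?thesis using per by blast
qed

section \<open>Convergence of nested series\<close>

text \<open>The sums start at 0; the summands used later vanish there because
  \<open>0 powr _ = 0\<close>, so in effect they run over positive integers.\<close>

fun nested_sum :: "('i \<Rightarrow> nat \<Rightarrow> 'a::comm_semiring_1) \<Rightarrow> 'i list \<Rightarrow> nat \<Rightarrow> 'a" where
  "nested_sum t [] m = 1"
| "nested_sum t (i # is) m = (\<Sum>n<m. t i n * nested_sum t is n)"

lemma nested_sum_nonneg:
  fixes t :: "'i \<Rightarrow> nat \<Rightarrow> real"
  shows "(\<And>i n. 0 \<le> t i n) \<Longrightarrow> 0 \<le> nested_sum t is m"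
  by (induction "is" arbitrary: m) (auto intro!: sum_nonneg)

lemma norm_nested_sum_le:
  fixes t :: "'i \<Rightarrow> nat \<Rightarrow> complex"
  shows "norm (nested_sum t is m) \<le> nested_sum (\<lambda>i n. norm (t i n)) is m"
  by (induction "is" arbitrary: m) (auto intro!: sum_norm_le mult_left_mono simp: norm_mult)

text \<open>Comparison with the integral of \<open>x powr (e - 1)\<close>, increment by increment
  through the mean value theorem. The power of 2 pays for moving the intermediate point
  \<open>z\<close> back to \<open>m\<close>: the quotient \<open>z / real m\<close> is between 1 and
  2, and \<open>e - 1\<close> may have either sign.\<close>

lemma sum_powr_le:
  assumes "e > 0"
  shows "(\<Sum>n<m. real n powr (e - 1)) \<le> 2 powr \<bar>e - 1\<bar> / e * real m powr e"
proof (induction m)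
  case (Suc m)
  have "real m powr (e - 1) \<le> 2 powr \<bar>e - 1\<bar> / e * (real (Suc m) powr e - real m powr e)"
  proof (cases "m = 0")
    case False
    then have m: "real m \<ge> 1" by simp
    have "\<exists>z. real m < z \<and> z < real (Suc m) \<and>
        real (Suc m) powr e - real m powr e = (real (Suc m) - real m) * (e * z powr (e - 1))"
      by (rule MVT2) (use m in \<open>auto intro!: derivative_eq_intros\<close>)
    then obtain z where z: "real m < z" "z < real (Suc m)"
      "real (Suc m) powr e - real m powr e = e * z powr (e - 1)" by auto
    have "real m powr (e - 1) = (real m / z) powr (e - 1) * z powr (e - 1)"
      using z m by (simp add: powr_divide)
    also have "(real m / z) powr (e - 1) = (z / real m) powr (1 - e)"
      using z m by (simp add: powr_divide powr_diff field_simps)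
    also have "\<dots> \<le> (z / real m) powr \<bar>e - 1\<bar>"
      using z m by (intro powr_mono) (auto simp: field_simps)
    also have "\<dots> \<le> 2 powr \<bar>e - 1\<bar>"
      using z m by (intro powr_mono2) (auto simp: field_simps)
    finally show ?thesis using assms z(3) by (simp add: mult_right_mono)
  qed (use assms in simp)
  with Suc show ?case by (simp add: algebra_simps)
qed simp

text \<open>
  \<open>conv x y is\<close> is the condition for absolute convergence of the series of
  \<open>n powr (-y)\<close> times the nested sum with exponents \<open>x\<close> over \<open>is\<close>: each summation
  raises the order of growth by one.
\<close>

fun conv :: "('i \<Rightarrow> real) \<Rightarrow> real \<Rightarrow> 'i list \<Rightarrow> bool" where
  "conv x y [] \<longleftrightarrow> y > 1"
| "conv x y (i # is) \<longleftrightarrow> y > 1 \<and> conv x (y + x i - 1) is"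

lemma conv_mono: "conv x y is \<Longrightarrow> y \<le> y' \<Longrightarrow> conv x y' is"
proof (induction "is" arbitrary: y y')
  case (Cons i "is")
  then show ?case using Cons.IH[of "y + x i - 1" "y' + x i - 1"] by auto
qed auto

text \<open>Finitely many strict inequalities survive a small decrease. The multiple
  \<open>k\<close> is general because every entry passed adds one more \<open>d\<close> to the loss
  in \<open>y\<close>.\<close>

lemma conv_eventually:
  "conv x y is \<Longrightarrow> \<forall>\<^sub>F d in at_right 0. conv (\<lambda>i. x i - d) (y - k * d) is"
proof (induction "is" arbitrary: y k)
  case Nil
  have "((\<lambda>d. y - k * d) \<longlongrightarrow> y - k * 0) (at_right 0)" by (intro tendsto_intros)
  then show ?case using Nil order_tendstoD(1) by force
next
  case (Cons i "is")
  have "((\<lambda>d. y - k * d) \<longlongrightarrow> y - k * 0) (at_right 0)" by (intro tendsto_intros)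
  then have "\<forall>\<^sub>F d in at_right 0. y - k * d > 1" using Cons.prems order_tendstoD(1) by force
  moreover have "\<forall>\<^sub>F d in at_right 0. conv (\<lambda>i. x i - d) ((y + x i - 1) - (k + 1) * d) is"
    using Cons by simp
  ultimately show ?case
    by eventually_elim (simp add: algebra_simps)
qed

lemma conv_decrease:
  assumes "conv x y is"
  obtains d where "d > 0" "conv (\<lambda>i. x i - d) (y - k * d) is"
proof -
  have "\<forall>\<^sub>F d in at_right 0. d > 0 \<and> conv (\<lambda>i. x i - d) (y - k * d) is"
    using assms by (intro eventually_conj conv_eventually) (auto simp: eventually_at_right_less)
  from eventually_happens'[OF trivial_limit_at_right_real this] show ?thesis using that by blast
qed

text \<open>Each layer multiplies by \<open>n powr (- x i)\<close> and sums, which moves the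
  exponent from \<open>e + x i - 1\<close> to \<open>e\<close>; \<open>conv\<close> keeps all these
  exponents positive, as \<open>sum_powr_le\<close> requires. \<open>C\<close> is chosen before
  \<open>t\<close>, so that one bound holds for all nearby \<open>s\<close>.\<close>

lemma nested_sum_bound:
  assumes "conv x (e + 1) is"
  shows "\<exists>C\<ge>0. \<forall>t. (\<forall>i n. 0 \<le> t i n \<and> t i n \<le> M * real n powr (- x i)) \<longrightarrow>
    (\<forall>n\<ge>1. nested_sum t is n \<le> C * real n powr e)"
  using assms
proof (induction "is" arbitrary: e)
  case Nil
  then show ?case by (intro exI[of _ 1]) (auto simp: ge_one_powr_ge_zero)
next
  case (Cons i "is")
  then have e: "e > 0" and "conv x ((e + x i - 1) + 1) is" by auto
  from Cons.IH[OF this(2)] obtain C where C: "C \<ge> 0"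
    "\<And>t n. (\<And>i n. 0 \<le> t i n \<and> t i n \<le> M * real n powr (- x i)) \<Longrightarrow> n \<ge> 1 \<Longrightarrow>
      nested_sum t is n \<le> C * real n powr (e + x i - 1)" by blast
  define C' where "C' = \<bar>M\<bar> * C * (2 powr \<bar>e - 1\<bar> / e)"
  have "nested_sum t (i # is) m \<le> C' * real m powr e"
    if t: "\<And>i n. 0 \<le> t i n \<and> t i n \<le> M * real n powr (- x i)" for t m
  proof -
    have "nested_sum t (i # is) m \<le> (\<Sum>n<m. \<bar>M\<bar> * C * real n powr (e - 1))"
      unfolding nested_sum.simps
    proof (rule sum_mono)
      fix n
      show "t i n * nested_sum t is n \<le> \<bar>M\<bar> * C * real n powr (e - 1)"
      proof (cases "n = 0")
        case True
        then show ?thesis using t[of i 0] by auto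
      next
        case False
        have "t i n \<le> \<bar>M\<bar> * real n powr (- x i)"
          using t[of i n] by (meson abs_ge_self mult_right_mono order_trans powr_ge_zero)
        then have "t i n * nested_sum t is n \<le> (\<bar>M\<bar> * real n powr (- x i)) * (C * real n powr (e + x i - 1))"
          using t False by (intro mult_mono C nested_sum_nonneg) auto
        also have "\<dots> = \<bar>M\<bar> * C * (real n powr (- x i) * real n powr (e + x i - 1))" by simp
        also have "real n powr (- x i) * real n powr (e + x i - 1) = real n powr (e - 1)"
          by (simp flip: powr_add)
        finally show ?thesis .
      qed
    qed
    also have "\<dots> \<le> C' * real m powr e"
      unfolding sum_distrib_left[symmetric] C'_def mult.assoc[of _ "2 powr \<bar>e - 1\<bar> / e"]
      using C(1) by (intro mult_left_mono sum_powr_le e) auto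
    finally show ?thesis .
  qed
  moreover have "C' \<ge> 0" using C e by (simp add: C'_def)
  ultimately show ?case by blast
qed

section \<open>Locally uniform convergence of nested series\<close>

definition dirichlet_term :: "('r \<Rightarrow> nat \<Rightarrow> complex) \<Rightarrow> complex ^ 'r::finite \<Rightarrow> 'r \<Rightarrow> nat \<Rightarrow> complex" where
  "dirichlet_term chi s i n = chi i n * of_nat n powr (- (s $ i))"

lemma norm_dirichlet_term_le:
  assumes "norm (chi i n) \<le> M" "y \<le> Re (s $ i)"
  shows "norm (dirichlet_term chi s i n) \<le> M * real n powr (- y)"
proof (cases "n = 0")
  case False
  then have "real n powr (- Re (s $ i)) \<le> real n powr (- y)"
    using assms(2) by (intro powr_mono) auto
  then show ?thesis
    using assms(1) order.trans[OF norm_ge_zero assms(1)]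
    by (auto simp: dirichlet_term_def norm_mult norm_powr_real_powr intro!: mult_mono)
qed (simp add: dirichlet_term_def)

lemma cdiff_nested_sum: "cdiff (\<lambda>s. nested_sum (dirichlet_term chi s) is n) a"
  by (induction "is" arbitrary: n)
    (auto intro!: cdiff_sum cdiff_mult cdiff_nat_powr cdiff_uminus simp: dirichlet_term_def)

text \<open>A common frame for both kinds of leading factors: periodic coefficients times powers,
  and Euler--Maclaurin errors. The decay rate moves with \<open>s\<close>; the constant is locally
  uniform.\<close>

definition dominated :: "(nat \<Rightarrow> complex ^ 'r::finite \<Rightarrow> complex) \<Rightarrow> (complex ^ 'r \<Rightarrow> complex) \<Rightarrow> bool" where
  "dominated e w \<longleftrightarrow> (\<forall>n s. cdiff (e n) s) \<and> (\<forall>s. cdiff w s) \<and>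
    (\<forall>a. \<exists>U C. open U \<and> a \<in> U \<and> (\<forall>s\<in>U. \<forall>n\<ge>1. norm (e n s) \<le> C * real n powr (- Re (w s))))"

lemma dominated_nat_powr:
  assumes "\<And>s. cdiff w s" "\<And>n. norm (f n) \<le> M"
  shows "dominated (\<lambda>n s. f n * of_nat n powr (- w s)) w"
  unfolding dominated_def
proof (intro conjI allI exI[of _ UNIV] exI[of _ M] ballI impI)
  fix n s
  show "norm (f n * of_nat n powr (- w s)) \<le> M * real n powr (- Re (w s))"
    using assms(2)[of n] by (simp add: norm_mult norm_powr_real_powr mult_right_mono)
qed (use assms(1) in \<open>auto intro!: cdiff_nat_powr cdiff_mult cdiff_uminus\<close>)

lemma dominated_mult:
  assumes "dominated e w" "dominated e' w'"
  shows "dominated (\<lambda>n s. e n s * e' n s) (\<lambda>s. w s + w' s)"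
  unfolding dominated_def
proof (intro conjI allI)
  fix a
  obtain U C U' C' where U: "open U" "a \<in> U" "\<And>s n. s \<in> U \<Longrightarrow> n \<ge> 1 \<Longrightarrow> norm (e n s) \<le> C * real n powr (- Re (w s))"
    and U': "open U'" "a \<in> U'" "\<And>s n. s \<in> U' \<Longrightarrow> n \<ge> 1 \<Longrightarrow> norm (e' n s) \<le> C' * real n powr (- Re (w' s))"
    using assms unfolding dominated_def by metis
  show "\<exists>U C. open U \<and> a \<in> U \<and> (\<forall>s\<in>U. \<forall>n\<ge>1. norm (e n s * e' n s) \<le> C * real n powr (- Re (w s + w' s)))"
  proof (intro exI conjI ballI allI impI)
    fix s n assume s: "s \<in> U \<inter> U'" and n: "n \<ge> (1::nat)"
    have "norm (e n s * e' n s) \<le> (C * real n powr (- Re (w s))) * (C' * real n powr (- Re (w' s)))"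
      unfolding norm_mult
      using U(3)[of s n] U'(3)[of s n] s n order.trans[OF norm_ge_zero] by (intro mult_mono) auto
    also have "\<dots> = C * C' * (real n powr (- Re (w s)) * real n powr (- Re (w' s)))" by simp
    finally show "norm (e n s * e' n s) \<le> C * C' * real n powr (- Re (w s + w' s))"
      by (simp flip: powr_add)
  qed (use U U' in auto)
qed (use assms in \<open>auto simp: dominated_def\<close>)

lemma cdiff_open_nhd:
  assumes "cdiff f a" "open S" "f a \<in> S"
  obtains U where "open U" "a \<in> U" "\<And>s. s \<in> U \<Longrightarrow> f s \<in> S"
  using assms cdiff_imp_isCont continuous_at_open by metis

lemma nested_series_majorant:
  assumes dom: "dominated e w" and chi: "\<And>i n. norm (chi i n) \<le> M"
    and conv: "conv (\<lambda>i. Re (a $ i)) (Re (w a)) is"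
  obtains U B where "open U" "a \<in> U" "summable B"
    "\<And>n s. s \<in> U \<Longrightarrow> norm (e n s) * nested_sum (\<lambda>i n. norm (dirichlet_term chi s i n)) is n \<le> B n"
proof -
  define y where "y = Re (w a)"
  \<comment> \<open>Of the loss \<open>2 * d\<close>, one \<open>d\<close> absorbs the variation of
    \<open>w\<close> near \<open>a\<close> and the other leaves the summable majorant
    \<open>n powr (- d - 1)\<close>. The loss \<open>d\<close> in each exponent covers the variation
    of the components on \<open>ball a d\<close>.\<close>
  obtain d where d: "d > 0" "conv (\<lambda>i. Re (a $ i) - d) ((y - 2 * d - 1) + 1) is"
    using conv_decrease[OF conv, of 2] by (auto simp: y_def)
  from nested_sum_bound[OF d(2), of M] obtain C where C: "C \<ge> 0"
    "\<And>t n. (\<forall>i n. 0 \<le> t i n \<and> t i n \<le> M * real n powr (- (Re (a $ i) - d))) \<Longrightarrow> n \<ge> 1 \<Longrightarrow>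
      nested_sum t is n \<le> C * real n powr (y - 2 * d - 1)" by blast
  obtain U1 D where U1: "open U1" "a \<in> U1" "\<And>s n. s \<in> U1 \<Longrightarrow> n \<ge> 1 \<Longrightarrow> norm (e n s) \<le> D * real n powr (- Re (w s))"
    using dom unfolding dominated_def by metis
  obtain U2 where U2: "open U2" "a \<in> U2" "\<And>s. s \<in> U2 \<Longrightarrow> w s \<in> {z. Re z > y - d}"
    by (rule cdiff_open_nhd[of w a "{z. Re z > y - d}"])
      (use dom d in \<open>auto simp: dominated_def y_def open_halfspace_Re_gt\<close>)
  obtain U3 where U3: "open U3" "a \<in> U3" "\<And>s. s \<in> U3 \<Longrightarrow> e 0 s \<in> ball (e 0 a) 1"
    by (rule cdiff_open_nhd[of "e 0" a "ball (e 0 a) 1"]) (use dom in \<open>auto simp: dominated_def\<close>)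
  define U where "U = U1 \<inter> U2 \<inter> U3 \<inter> ball a d"
  \<comment> \<open>The power bound is silent at \<open>n = 0\<close>. There
    \<open>nested_sum\<close> is 1 for the empty list and 0 otherwise, and continuity bounds
    \<open>e 0\<close>.\<close>
  define B where "B n = (if n = 0 then norm (e 0 a) + 1 else \<bar>D\<bar> * C * real n powr (- d - 1))" for n
  show ?thesis
  proof (rule that[of U B])
    have "summable (\<lambda>n. \<bar>D\<bar> * C * real n powr (- d - 1))"
      using d by (intro summable_mult) (simp add: summable_real_powr_iff)
    moreover have "\<forall>\<^sub>F n in sequentially. B n = \<bar>D\<bar> * C * real n powr (- d - 1)"
      using eventually_gt_at_top[of 0] by eventually_elim (simp add: B_def)
    ultimately show "summable B" by (simp add: summable_cong)
    fix n s assume s: "s \<in> U"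
    define t where "t = (\<lambda>i n. norm (dirichlet_term chi s i n))"
    show "norm (e n s) * nested_sum t is n \<le> B n"
    proof (cases "n = 0")
      case True
      have "norm (e 0 s) \<le> norm (e 0 a) + 1"
        using U3(3)[of s] s norm_triangle_ineq2[of "e 0 s" "e 0 a"]
        by (simp add: U_def dist_norm norm_minus_commute)
      moreover have "nested_sum t is 0 \<in> {0, 1}" by (cases "is") auto
      ultimately show ?thesis using True by (auto simp: B_def add_nonneg_nonneg)
    next
      case False
      then have n: "real n \<ge> 1" "n \<ge> 1" by auto
      have "Re (s $ i) \<ge> Re (a $ i) - d" for i
      proof -
        have "\<bar>Re ((a - s) $ i)\<bar> \<le> norm (a - s)"
          using abs_Re_le_cmod component_le_norm_cart order.trans
          by (meson Finite_Cartesian_Product.norm_nth_le)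
        moreover have "norm (a - s) < d" using s by (simp add: U_def dist_norm)
        ultimately show ?thesis by simp
      qed
      then have "nested_sum t is n \<le> C * real n powr (y - 2 * d - 1)"
        unfolding t_def by (intro C(2) n allI conjI norm_ge_zero norm_dirichlet_term_le chi)
      moreover have "norm (e n s) \<le> \<bar>D\<bar> * real n powr (- (y - d))"
      proof -
        have "norm (e n s) \<le> D * real n powr (- Re (w s))" using U1(3) s n by (simp add: U_def)
        also have "\<dots> \<le> \<bar>D\<bar> * real n powr (- Re (w s))" by (simp add: mult_right_mono)
        also have "\<dots> \<le> \<bar>D\<bar> * real n powr (- (y - d))"
          using U2(3)[of s] s n by (intro mult_left_mono powr_mono) (auto simp: U_def)
        finally show ?thesis .
      qed
      ultimately have "norm (e n s) * nested_sum t is n \<le>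
          (\<bar>D\<bar> * real n powr (- (y - d))) * (C * real n powr (y - 2 * d - 1))"
        by (intro mult_mono nested_sum_nonneg) (auto simp: t_def)
      also have "\<dots> = \<bar>D\<bar> * C * (real n powr (- (y - d)) * real n powr (y - 2 * d - 1))" by simp
      also have "real n powr (- (y - d)) * real n powr (y - 2 * d - 1) = real n powr (- d - 1)"
        by (simp flip: powr_add)
      finally show ?thesis using False by (simp add: B_def)
    qed
  qed (use U1 U2 U3 d in \<open>auto simp: U_def\<close>)
qed

lemma nested_series:
  assumes dom: "dominated e w" and chi: "\<And>i n. norm (chi i n) \<le> M"
    and conv: "conv (\<lambda>i. Re (a $ i)) (Re (w a)) is"
  shows "summable (\<lambda>n. norm (e n a) * nested_sum (\<lambda>i n. norm (dirichlet_term chi a i n)) is n)"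
    and "summable (\<lambda>n. e n a * nested_sum (dirichlet_term chi a) is n)"
    and "cdiff (\<lambda>s. \<Sum>n. e n s * nested_sum (dirichlet_term chi s) is n) a"
proof -
  obtain U B where U: "open U" "a \<in> U" and B: "summable B"
    "\<And>n s. s \<in> U \<Longrightarrow> norm (e n s) * nested_sum (\<lambda>i n. norm (dirichlet_term chi s i n)) is n \<le> B n"
    using nested_series_majorant[where chi = chi, OF dom chi conv] by blast
  have le: "norm (e n s * nested_sum (dirichlet_term chi s) is n) \<le> B n" if "s \<in> U" for n s
  proof -
    have "norm (e n s * nested_sum (dirichlet_term chi s) is n)
        \<le> norm (e n s) * nested_sum (\<lambda>i n. norm (dirichlet_term chi s i n)) is n"
      unfolding norm_mult by (intro mult_left_mono norm_nested_sum_le) auto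
    also have "\<dots> \<le> B n" by (rule B(2)[OF that])
    finally show ?thesis .
  qed
  show "summable (\<lambda>n. norm (e n a) * nested_sum (\<lambda>i n. norm (dirichlet_term chi a i n)) is n)"
  proof (rule summable_comparison_test'[OF B(1)])
    fix n
    show "norm (norm (e n a) * nested_sum (\<lambda>i n. norm (dirichlet_term chi a i n)) is n) \<le> B n"
      using B(2)[OF U(2), of n] by (simp add: nested_sum_nonneg)
  qed
  show "summable (\<lambda>n. e n a * nested_sum (dirichlet_term chi a) is n)"
    using B(1) le[OF U(2)] by (rule summable_comparison_test')
  show "cdiff (\<lambda>s. \<Sum>n. e n s * nested_sum (dirichlet_term chi s) is n) a"
  proof (rule cdiff_suminf[OF U _ _ B(1)])
    show "cdiff (\<lambda>s. e n s * nested_sum (dirichlet_term chi s) is n) s" for n s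
      using dom by (intro cdiff_mult cdiff_nested_sum) (auto simp: dominated_def)
  qed (rule le)
qed

definition nested_series_value ::
  "('r \<Rightarrow> nat \<Rightarrow> complex) \<Rightarrow> 'r::finite list \<Rightarrow> (nat \<Rightarrow> complex) \<Rightarrow> complex \<Rightarrow> complex ^ 'r \<Rightarrow> complex" where
  "nested_series_value chi is f w s = (\<Sum>n. f n * of_nat n powr (- w) * nested_sum (dirichlet_term chi s) is n)"

text \<open>With \<open>0 powr _ = 0\<close>, the lower boundary term of the summation by parts
  disappears.\<close>

lemma EM_sum_0 [simp]: "EM_sum \<phi> K z 0 = 0"
  by (simp add: EM_sum_def powr_deriv_def)

text \<open>The upper boundary term. Strictness of \<open>conv\<close> gives a spare
  \<open>d\<close>: the nested sum is of order at most \<open>n powr (Re w - d - 1)\<close>, its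
  factor of order at most \<open>n powr (1 - Re w)\<close>, with \<open>k = 0\<close> the worst
  case.\<close>

lemma nested_tendsto_0:
  assumes chi: "\<And>i n. norm (chi i n) \<le> M" and conv: "conv (\<lambda>i. Re (s $ i)) (Re w) is"
    and \<phi>: "\<And>n. norm (\<phi> n) \<le> B"
  shows "(\<lambda>n. \<phi> n * of_nat n powr (1 - w - of_nat k) * nested_sum (dirichlet_term chi s) is n) \<longlonglongrightarrow> 0"
proof -
  obtain d where d: "d > 0" "conv (\<lambda>i. Re (s $ i) - d) ((Re w - d - 1) + 1) is"
    using conv_decrease[OF conv, of 1] by auto
  from nested_sum_bound[OF d(2), of M] obtain C where C: "C \<ge> 0"
    "\<And>t n. (\<forall>i n. 0 \<le> t i n \<and> t i n \<le> M * real n powr (- (Re (s $ i) - d))) \<Longrightarrow> n \<ge> 1 \<Longrightarrow>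
      nested_sum t is n \<le> C * real n powr (Re w - d - 1)" by blast
  have B: "B \<ge> 0" using order.trans[OF norm_ge_zero \<phi>] .
  have le: "norm (\<phi> n * of_nat n powr (1 - w - of_nat k) * nested_sum (dirichlet_term chi s) is n) \<le> B * C * real n powr (- d)"
    if n: "n \<ge> 1" for n
  proof -
    have "nested_sum (\<lambda>i n. norm (dirichlet_term chi s i n)) is n \<le> C * real n powr (Re w - d - 1)"
      using d by (intro C(2) n allI conjI norm_ge_zero norm_dirichlet_term_le chi) simp
    then have A: "norm (nested_sum (dirichlet_term chi s) is n) \<le> C * real n powr (Re w - d - 1)"
      using norm_nested_sum_le order.trans by blast
    have "real n powr (1 - Re w - real k) \<le> real n powr (1 - Re w)"
      using n by (intro powr_mono) auto
    then have "norm (\<phi> n * of_nat n powr (1 - w - of_nat k) * nested_sum (dirichlet_term chi s) is n)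
        \<le> B * real n powr (1 - Re w) * (C * real n powr (Re w - d - 1))"
      unfolding norm_mult using \<phi>[of n] A B C
      by (intro mult_mono) (auto simp: norm_powr_real_powr)
    also have "\<dots> = B * C * (real n powr (1 - Re w) * real n powr (Re w - d - 1))" by simp
    also have "real n powr (1 - Re w) * real n powr (Re w - d - 1) = real n powr (- d)"
      by (simp flip: powr_add)
    finally show ?thesis .
  qed
  show ?thesis
  proof (rule Lim_null_comparison)
    show "\<forall>\<^sub>F n in sequentially. norm (\<phi> n * of_nat n powr (1 - w - of_nat k) *
        nested_sum (dirichlet_term chi s) is n) \<le> B * C * real n powr (- d)"
      using eventually_ge_at_top[of 1] by eventually_elim (rule le)
    show "(\<lambda>n. B * C * real n powr (- d)) \<longlonglongrightarrow> 0"
      using d by (intro tendsto_mult_right_zero tendsto_neg_powr filterlim_real_sequentially) simp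
  qed
qed

text \<open>By the definition of \<open>EM_error\<close> the bracket is the forward difference of
  \<open>EM_sum\<close> times \<open>A n\<close>, so each summand is the difference of a product by
  the discrete product rule, which also accounts for the \<open>Suc n\<close>.\<close>

lemma EM_summation_by_parts:
  "(\<Sum>n<N. ((1 - w) * (f n * of_nat n powr (- w) * A n) + EM_error f \<phi> K (1 - w) n * A n)
      + EM_sum \<phi> K (1 - w) (Suc n) * (A (Suc n) - A n)) = EM_sum \<phi> K (1 - w) N * A N"
  by (induction N) (auto simp: EM_error_def algebra_simps)

section \<open>Summation by parts\<close>

lemma cdiff_falling: "cdiff f a \<Longrightarrow> cdiff (\<lambda>s. falling k (f s)) a"
  unfolding falling_def by (intro cdiff_prod cdiff_diff cdiff_const)

lemma cdiff_EM_error: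
  assumes "cdiff f a"
  shows "cdiff (\<lambda>s. EM_error g \<phi> K (f s) n) a"
  unfolding EM_error_def EM_sum_def powr_deriv_def
  by (intro cdiff_sum cdiff_mult cdiff_diff cdiff_const cdiff_nat_powr cdiff_falling assms)

text \<open>With \<open>z = 1 - w\<close> the exponent \<open>Re z - real (Suc K)\<close> is
  \<open>- Re (w + of_nat K)\<close>: the error gains \<open>K\<close> powers of \<open>n\<close>. A
  unit ball around \<open>1 - w a\<close> supplies the bound on \<open>z\<close>.\<close>

lemma dominated_EM_error:
  fixes w :: "complex ^ 'r::finite \<Rightarrow> complex"
  assumes w: "\<And>s. cdiff w s"
    and bd: "EM_error_small f \<phi> K"
  shows "dominated (\<lambda>n s. EM_error f \<phi> K (1 - w s) n) (\<lambda>s. w s + of_nat K)"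
  unfolding dominated_def
proof (intro conjI allI)
  fix a
  obtain U where U: "open U" "a \<in> U" "\<And>s. s \<in> U \<Longrightarrow> 1 - w s \<in> ball (1 - w a) 1"
    by (rule cdiff_open_nhd[of "\<lambda>s. 1 - w s" a "ball (1 - w a) 1"]) (use w in auto)
  define R where "R = norm (1 - w a) + 1"
  obtain C where C: "\<And>z n. norm z \<le> R \<Longrightarrow> n \<ge> 1 \<Longrightarrow> norm (EM_error f \<phi> K z n) \<le> C * real n powr (Re z - real (Suc K))"
    using bd unfolding EM_error_small_def by blast
  have "norm (1 - w s) \<le> R" if "s \<in> U" for s
    using U(3)[OF that] norm_triangle_ineq2[of "1 - w s" "1 - w a"]
    by (simp add: R_def dist_norm norm_minus_commute)
  then have "norm (EM_error f \<phi> K (1 - w s) n) \<le> C * real n powr (- Re (w s + of_nat K))" if "s \<in> U" "n \<ge> 1" for s n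
    using C[of "1 - w s" n] that by (simp add: algebra_simps)
  then show "\<exists>U C. open U \<and> a \<in> U \<and> (\<forall>s\<in>U. \<forall>n\<ge>1. norm (EM_error f \<phi> K (1 - w s) n) \<le> C * real n powr (- Re (w s + of_nat K)))"
    using U by blast
qed (auto intro!: cdiff_EM_error w)

lemma EM_sum_nested_tendsto_0:
  assumes chi: "\<And>i n. norm (chi i n) \<le> M" and conv: "conv (\<lambda>i. Re (s $ i)) (Re w) is"
    and \<phi>: "\<And>k. k \<le> K \<Longrightarrow> \<exists>B. \<forall>n. norm (\<phi> k n) \<le> B"
  shows "(\<lambda>n. EM_sum \<phi> K (1 - w) n * nested_sum (dirichlet_term chi s) is n) \<longlonglongrightarrow> 0"
proof -
  have "(\<lambda>n. \<Sum>k\<le>K. falling k (1 - w) * (\<phi> k n * of_nat n powr (1 - w - of_nat k) * nested_sum (dirichlet_term chi s) is n))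
      \<longlonglongrightarrow> (\<Sum>k\<le>K. falling k (1 - w) * 0)"
  proof (intro tendsto_intros)
    fix k assume "k \<in> {..K}"
    then obtain B where "\<And>n. norm (\<phi> k n) \<le> B" using \<phi> by auto
    then show "(\<lambda>n. \<phi> k n * of_nat n powr (1 - w - of_nat k) * nested_sum (dirichlet_term chi s) is n) \<longlonglongrightarrow> 0"
      by (rule nested_tendsto_0[where chi = chi, OF chi conv])
  qed
  then show ?thesis
    by (simp add: EM_sum_def powr_deriv_def sum_distrib_right sum_distrib_left algebra_simps)
qed

lemma nested_series_value_sums:
  assumes chi: "\<And>i n. norm (chi i n) \<le> M" and f: "\<And>n. norm (f n) \<le> B"
    and conv: "conv (\<lambda>i. Re (s $ i)) (Re w) is"
  shows "(\<lambda>n. f n * of_nat n powr (- w) * nested_sum (dirichlet_term chi s) is n) sums nested_series_value chi is f w s"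
  unfolding nested_series_value_def
  by (rule summable_sums,
      rule nested_series(2)[where chi = chi and e = "\<lambda>n s. f n * of_nat n powr (- w)" and w = "\<lambda>_. w"])
    (auto intro!: dominated_nat_powr assms)

definition EM_remainder ::
  "('r \<Rightarrow> nat \<Rightarrow> complex) \<Rightarrow> 'r::finite list \<Rightarrow> (nat \<Rightarrow> complex) \<Rightarrow> (nat \<Rightarrow> nat \<Rightarrow> complex) \<Rightarrow> nat \<Rightarrow> complex \<Rightarrow> complex ^ 'r \<Rightarrow> complex" where
  "EM_remainder chi is f \<phi> K z s = (\<Sum>n. EM_error f \<phi> K z n * nested_sum (dirichlet_term chi s) is n)"

text \<open>The nested sum of the empty list is constantly 1, so its differences vanish and only the
  error series remains in the limit.\<close>

lemma EM_nested_Nil: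
  assumes chi: "\<And>i n. norm (chi i n) \<le> M" and f: "\<And>n. norm (f n) \<le> B"
    and \<phi>: "\<And>k. k \<le> K \<Longrightarrow> \<exists>B. \<forall>n. norm (\<phi> k n) \<le> B"
    and bd: "EM_error_small f \<phi> K"
    and conv: "conv (\<lambda>i. Re (s $ i)) (Re w) []"
  shows "(1 - w) * nested_series_value chi [] f w s = - EM_remainder chi [] f \<phi> K (1 - w) s"
proof -
  let ?A = "nested_sum (dirichlet_term chi s) []"
  have 1: "(\<lambda>n. f n * of_nat n powr (- w) * ?A n) sums nested_series_value chi [] f w s"
    by (rule nested_series_value_sums[where chi = chi, OF chi f conv])
  have 2: "(\<lambda>n. EM_error f \<phi> K (1 - w) n * ?A n) sums EM_remainder chi [] f \<phi> K (1 - w) s"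
    unfolding EM_remainder_def
    by (rule summable_sums, rule nested_series(2)[where chi = chi, OF dominated_EM_error chi conv_mono[OF conv], of "\<lambda>_. w"])
      (auto intro: bd)
  have "(\<lambda>n. (1 - w) * (f n * of_nat n powr (- w) * ?A n) + EM_error f \<phi> K (1 - w) n * ?A n)
    sums ((1 - w) * nested_series_value chi [] f w s + EM_remainder chi [] f \<phi> K (1 - w) s)"
    by (intro sums_add sums_mult 1 2)
  then have "(\<lambda>N. EM_sum \<phi> K (1 - w) N * ?A N) \<longlonglongrightarrow> (1 - w) * nested_series_value chi [] f w s + EM_remainder chi [] f \<phi> K (1 - w) s"
    unfolding sums_def using EM_summation_by_parts[of w f ?A \<phi> K] by simp
  then have "(1 - w) * nested_series_value chi [] f w s + EM_remainder chi [] f \<phi> K (1 - w) s = 0"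
    by (rule LIMSEQ_unique) (rule EM_sum_nested_tendsto_0[where chi = chi, OF chi conv \<phi>])
  then show ?thesis by (simp add: eq_neg_iff_add_eq_0)
qed

definition EM_remainder' ::
  "('r \<Rightarrow> nat \<Rightarrow> complex) \<Rightarrow> 'r \<Rightarrow> 'r::finite list \<Rightarrow> (nat \<Rightarrow> complex) \<Rightarrow> (nat \<Rightarrow> nat \<Rightarrow> complex) \<Rightarrow> nat \<Rightarrow> complex \<Rightarrow> complex ^ 'r \<Rightarrow> complex" where
  "EM_remainder' chi i is f \<phi> K z s =
    (\<Sum>n. EM_error f \<phi> K z n * (chi i n * of_nat n powr (- (s $ i))) * nested_sum (dirichlet_term chi s) is n)"

lemma dominated_EM_error':
  assumes chi: "\<And>i n. norm (chi i n) \<le> M" and w: "\<And>s. cdiff w s"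
    and bd: "EM_error_small f \<phi> K"
  shows "dominated (\<lambda>n s. EM_error f \<phi> K (1 - w s) n * (chi i n * of_nat n powr (- (s $ i)))) (\<lambda>s. w s + of_nat K + s $ i)"
  by (rule dominated_mult[OF dominated_EM_error[OF w bd] dominated_nat_powr[OF cdiff_component chi]])

text \<open>Taking the difference of the nested sum strips off its outermost layer, which is why all
  series on the right but the last run over the shorter list; the last is the error of the summation
  by parts itself.\<close>

lemma EM_nested_Cons:
  assumes chi: "\<And>i n. norm (chi i n) \<le> M" and f: "\<And>n. norm (f n) \<le> B"
    and \<phi>: "\<And>k. k \<le> K \<Longrightarrow> \<exists>B. \<forall>n. norm (\<phi> k n) \<le> B"
    and bd: "EM_error_small f \<phi> K"
    and conv: "conv (\<lambda>i. Re (s $ i)) (Re w) (i # is)"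
  shows "(1 - w) * nested_series_value chi (i # is) f w s = - (
     (\<Sum>k\<le>K. falling k (1 - w) * nested_series_value chi is (\<lambda>n. \<phi> k n * chi i n) (w - 1 + of_nat k + s $ i) s)
     + (1 - w) * nested_series_value chi is (\<lambda>n. f n * chi i n) (w + s $ i) s
     + EM_remainder' chi i is f \<phi> K (1 - w) s + EM_remainder chi (i # is) f \<phi> K (1 - w) s)"
proof -
  let ?A = "nested_sum (dirichlet_term chi s) (i # is)"
  let ?A' = "nested_sum (dirichlet_term chi s) is"
  let ?d = "dirichlet_term chi s i"
  have conv': "conv (\<lambda>i. Re (s $ i)) (Re w + Re (s $ i) - 1) is" using conv by simp
  have M: "M \<ge> 0" and B: "B \<ge> 0" using order.trans[OF norm_ge_zero] chi f by blast+
  have S1: "(\<lambda>n. f n * of_nat n powr (- w) * ?A n) sums nested_series_value chi (i # is) f w s"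
    by (rule nested_series_value_sums[where chi = chi, OF chi f conv])
  have S2: "(\<lambda>n. EM_error f \<phi> K (1 - w) n * ?A n) sums EM_remainder chi (i # is) f \<phi> K (1 - w) s"
    unfolding EM_remainder_def
    by (rule summable_sums, rule nested_series(2)[where chi = chi, OF dominated_EM_error chi conv_mono[OF conv], of "\<lambda>_. w"])
      (auto intro: bd)
  have S3: "(\<lambda>n. EM_error f \<phi> K (1 - w) n * (chi i n * of_nat n powr (- (s $ i))) * ?A' n) sums EM_remainder' chi i is f \<phi> K (1 - w) s"
    unfolding EM_remainder'_def
    by (rule summable_sums, rule nested_series(2)[where chi = chi, OF dominated_EM_error' chi conv_mono[OF conv'], of chi M "\<lambda>_. w"])
      (auto intro: bd chi)
  have S4: "(\<lambda>n. (f n * chi i n) * of_nat n powr (- (w + s $ i)) * ?A' n) sums nested_series_value chi is (\<lambda>n. f n * chi i n) (w + s $ i) s"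
    by (rule nested_series_value_sums[where chi = chi and B = "B * M", OF chi _ conv_mono[OF conv']])
      (use M B in \<open>auto simp: norm_mult intro!: mult_mono f chi\<close>)
  have S5: "(\<lambda>n. (\<phi> k n * chi i n) * of_nat n powr (- (w - 1 + of_nat k + s $ i)) * ?A' n)
      sums nested_series_value chi is (\<lambda>n. \<phi> k n * chi i n) (w - 1 + of_nat k + s $ i) s" if k: "k \<le> K" for k
  proof -
    obtain b where b: "\<And>n. norm (\<phi> k n) \<le> b" using \<phi>[OF k] by blast
    then have "b \<ge> 0" using order.trans[OF norm_ge_zero] by blast
    then show ?thesis
      by (intro nested_series_value_sums[where chi = chi and B = "b * M", OF chi _ conv_mono[OF conv']])
        (use M in \<open>auto simp: norm_mult intro!: mult_mono b chi\<close>)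
  qed
  have pm: "of_nat n powr (- (a + b)) = of_nat n powr (- a) * of_nat n powr (- b)" for n and a b :: complex
    by (simp add: powr_add[symmetric])
  have diff: "EM_sum \<phi> K (1 - w) (Suc n) * (?A (Suc n) - ?A n) =
    (\<Sum>k\<le>K. falling k (1 - w) * ((\<phi> k n * chi i n) * of_nat n powr (- (w - 1 + of_nat k + s $ i)) * ?A' n))
    + (1 - w) * ((f n * chi i n) * of_nat n powr (- (w + s $ i)) * ?A' n)
    + EM_error f \<phi> K (1 - w) n * (chi i n * of_nat n powr (- (s $ i))) * ?A' n" for n
  proof -
    \<comment> \<open>The layer stripped off sits at \<open>n\<close>, so \<open>EM_sum\<close> is
      brought back from \<open>Suc n\<close> to \<open>n\<close>. This creates the series with
      exponent \<open>w + s $ i\<close> and the error series over the shorter list.\<close>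
    have e: "EM_sum \<phi> K (1 - w) (Suc n) = EM_sum \<phi> K (1 - w) n + (1 - w) * (f n * of_nat n powr (- w)) + EM_error f \<phi> K (1 - w) n"
      by (simp add: EM_error_def algebra_simps)
    have "EM_sum \<phi> K (1 - w) n * (?d n * ?A' n) =
      (\<Sum>k\<le>K. falling k (1 - w) * ((\<phi> k n * chi i n) * of_nat n powr (- (w - 1 + of_nat k + s $ i)) * ?A' n))"
      unfolding EM_sum_def sum_distrib_right pm[of n _ "s $ i"] powr_deriv_def dirichlet_term_def
      by (intro sum.cong) (auto simp: algebra_simps)
    moreover have "?A (Suc n) - ?A n = ?d n * ?A' n" by simp
    ultimately show ?thesis
      unfolding e pm[of n w "s $ i"] by (simp add: dirichlet_term_def algebra_simps)
  qed
  have "(\<lambda>n. ((1 - w) * (f n * of_nat n powr (- w) * ?A n) + EM_error f \<phi> K (1 - w) n * ?A n)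
     + EM_sum \<phi> K (1 - w) (Suc n) * (?A (Suc n) - ?A n))
    sums (((1 - w) * nested_series_value chi (i # is) f w s + EM_remainder chi (i # is) f \<phi> K (1 - w) s) +
     ((\<Sum>k\<le>K. falling k (1 - w) * nested_series_value chi is (\<lambda>n. \<phi> k n * chi i n) (w - 1 + of_nat k + s $ i) s)
     + (1 - w) * nested_series_value chi is (\<lambda>n. f n * chi i n) (w + s $ i) s
     + EM_remainder' chi i is f \<phi> K (1 - w) s))"
    (is "_ sums ?T")
    unfolding diff by (intro sums_add sums_mult sums_sum S1 S2 S3 S4 S5) auto
  then have "(\<lambda>N. EM_sum \<phi> K (1 - w) N * ?A N) \<longlonglongrightarrow> ?T"
    unfolding sums_def EM_summation_by_parts .
  then have T0: "?T = 0"
    by (rule LIMSEQ_unique) (rule EM_sum_nested_tendsto_0[where chi = chi, OF chi conv \<phi>])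
  have alg: "a = - (b + c + d + e)" if "(a + e) + (b + c + d) = 0" for a b c d e :: complex
    using that by algebra
  show ?thesis by (rule alg[OF T0])
qed

section \<open>Poles along hyperplanes\<close>

lemma cdiff_partial_sum: "cdiff (\<lambda>s. partial_sum s i) a"
  unfolding partial_sum_def by (intro cdiff_sum cdiff_component)

lemma continuous_partial_sum: "continuous_on UNIV (\<lambda>s. partial_sum s i)"
  using cdiff_partial_sum cdiff_imp_isCont by (fastforce intro!: continuous_at_imp_continuous_on)

definition polar_index :: "'r::{finite,linorder} \<Rightarrow> int \<Rightarrow> bool" where
  "polar_index i n \<longleftrightarrow> (position i = 1 \<and> n = 1) \<or> (position i \<ge> 2 \<and> n \<le> int (position i))"

definition polar_forms_from :: "'r::{finite,linorder} \<Rightarrow> (complex ^ 'r::{finite,linorder} \<Rightarrow> complex) set" where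
  "polar_forms_from i = {(\<lambda>s. partial_sum s j - of_int n) | j n. i \<le> j \<and> polar_index j n}"

lemma polar_forms_eq: "polar_forms = {(\<lambda>s. partial_sum s j - of_int n) | j n. polar_index j n}"
  by (simp add: polar_forms_def polar_index_def)

lemma ball_polar_forms:
  "(\<forall>l\<in>polar_forms. P l) \<longleftrightarrow> (\<forall>i n. polar_index i n \<longrightarrow> P (\<lambda>s. partial_sum s i - of_int n))"
  unfolding polar_forms_eq by blast

lemma polar_forms_from_subset: "polar_forms_from i \<subseteq> polar_forms"
  by (auto simp: polar_forms_from_def polar_forms_eq)

lemma polar_forms_from_mono: "i \<le> j \<Longrightarrow> polar_forms_from j \<subseteq> polar_forms_from i"
  by (fastforce simp: polar_forms_from_def)

lemma cdiff_polar_form: "l \<in> polar_forms \<Longrightarrow> cdiff l a"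
  by (auto simp: polar_forms_eq intro!: cdiff_diff cdiff_partial_sum)

text \<open>For each of the finitely many indices at most one integer matches the partial sum of
  \<open>a\<close>.\<close>

lemma finite_vanishing_forms: "finite {l \<in> polar_forms. l a = 0}"
proof (rule finite_subset)
  show "{l \<in> polar_forms. l a = 0} \<subseteq> range (\<lambda>i s. partial_sum s i - partial_sum a i)"
  proof
    fix l assume "l \<in> {l \<in> polar_forms. l a = 0}"
    then obtain j n where l: "l = (\<lambda>s. partial_sum s j - of_int n)" "partial_sum a j = of_int n"
      by (auto simp: polar_forms_eq)
    have "l = (\<lambda>s. partial_sum s j - partial_sum a j)" unfolding l ..
    then show "l \<in> range (\<lambda>i s. partial_sum s i - partial_sum a i)" by (rule range_eqI)
  qed
qed simp

lemma finite_vanishing_subset: "\<Lambda> \<subseteq> polar_forms \<Longrightarrow> finite {l \<in> \<Lambda>. l a = 0}"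
  by (rule finite_subset[OF _ finite_vanishing_forms]) auto

text \<open>The hyperplanes may be infinite in number, but those of one index form the preimage of a
  set of integers, which is closed.\<close>

lemma open_avoid_hyperplanes:
  "open {s. \<forall>i n. P i n \<longrightarrow> partial_sum s i \<noteq> of_int n}"
proof -
  have "{s. \<forall>i n. P i n \<longrightarrow> partial_sum s i \<noteq> of_int n}
    = (\<Inter>i. (\<lambda>s. partial_sum s i) -` (- (of_int ` {n. P i n})))" by auto
  moreover have "open ((\<lambda>s. partial_sum s i) -` (- (of_int ` {n. P i n})))" for i
    by (intro open_vimage continuous_partial_sum open_Compl closed_of_int_image)
  ultimately show ?thesis by (simp add: open_INT)
qed

lemma open_off_hyperplanes:
  "open (off_hyperplanes (polar_forms :: (complex ^ 'r::{finite,linorder} \<Rightarrow> complex) set))"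
proof -
  have "off_hyperplanes (polar_forms :: (complex ^ 'r::{finite,linorder} \<Rightarrow> complex) set) = {s. \<forall>i n. polar_index i n \<longrightarrow> partial_sum s i \<noteq> of_int n}"
    by (simp add: off_hyperplanes_def ball_polar_forms)
  then show ?thesis by (simp add: open_avoid_hyperplanes)
qed

lemma open_nonvanishing_forms: "open {s. \<forall>l\<in>polar_forms. l a \<noteq> 0 \<longrightarrow> l s \<noteq> 0}"
proof -
  have "{s. \<forall>l\<in>polar_forms. l a \<noteq> 0 \<longrightarrow> l s \<noteq> 0} =
      {s. \<forall>i n. polar_index i n \<and> partial_sum a i \<noteq> of_int n \<longrightarrow> partial_sum s i \<noteq> of_int n}"
    by (auto simp: ball_polar_forms)
  then show ?thesis using open_avoid_hyperplanes[of "\<lambda>i n. polar_index i n \<and> partial_sum a i \<noteq> of_int n"] by simp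
qed

text \<open>The local claim for a variable set \<open>\<Lambda>\<close> of admissible poles. The
  identity is required only off all of \<open>polar_forms\<close>, so that functions with different
  \<open>\<Lambda>\<close> share one exceptional set and can be added; on it, quotients by zero may
  occur.\<close>

definition mild_poles :: "(complex ^ 'r::{finite,linorder} \<Rightarrow> complex) set \<Rightarrow> (complex ^ 'r::{finite,linorder} \<Rightarrow> complex) \<Rightarrow> (complex ^ 'r::{finite,linorder}) set \<Rightarrow> bool" where
  "mild_poles \<Lambda> F U \<longleftrightarrow> (\<forall>a\<in>U. \<exists>V g. open V \<and> a \<in> V \<and> (\<forall>s\<in>V. cdiff g s) \<and>
     (\<forall>s \<in> V \<inter> off_hyperplanes polar_forms. F s * (\<Prod>l | l \<in> \<Lambda> \<and> l a = 0. l s) = g s))"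

lemma mild_polesE:
  assumes "mild_poles \<Lambda> F U" "a \<in> U"
  obtains V g where "open V" "a \<in> V" "\<And>s. s \<in> V \<Longrightarrow> cdiff g s"
    "\<And>s. s \<in> V \<Longrightarrow> s \<in> off_hyperplanes polar_forms \<Longrightarrow> F s * (\<Prod>l | l \<in> \<Lambda> \<and> l a = 0. l s) = g s"
proof -
  obtain V g where "open V" "a \<in> V" "\<forall>s\<in>V. cdiff g s"
    "\<forall>s \<in> V \<inter> off_hyperplanes polar_forms. F s * (\<Prod>l | l \<in> \<Lambda> \<and> l a = 0. l s) = g s"
    using bspec[OF assms(1)[unfolded mild_poles_def] assms(2)] by (elim exE conjE) (rule that)
  then show ?thesis by (intro that[of V g]) auto
qed

lemma mild_poles_add:
  assumes "mild_poles \<Lambda> F U" "mild_poles \<Lambda> G U"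
  shows "mild_poles \<Lambda> (\<lambda>s. F s + G s) U"
  unfolding mild_poles_def
proof
  fix a assume a: "a \<in> U"
  obtain V g where V: "open V" "a \<in> V" "\<And>s. s \<in> V \<Longrightarrow> cdiff g s"
    "\<And>s. s \<in> V \<Longrightarrow> s \<in> off_hyperplanes polar_forms \<Longrightarrow> F s * (\<Prod>l | l \<in> \<Lambda> \<and> l a = 0. l s) = g s"
    using mild_polesE[OF assms(1) a] by blast
  obtain W h where W: "open W" "a \<in> W" "\<And>s. s \<in> W \<Longrightarrow> cdiff h s"
    "\<And>s. s \<in> W \<Longrightarrow> s \<in> off_hyperplanes polar_forms \<Longrightarrow> G s * (\<Prod>l | l \<in> \<Lambda> \<and> l a = 0. l s) = h s"
    using mild_polesE[OF assms(2) a] by blast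
  show "\<exists>V g. open V \<and> a \<in> V \<and> (\<forall>s\<in>V. cdiff g s) \<and>
     (\<forall>s \<in> V \<inter> off_hyperplanes polar_forms. (F s + G s) * (\<Prod>l | l \<in> \<Lambda> \<and> l a = 0. l s) = g s)"
    using V W by (intro exI[of _ "V \<inter> W"] exI[of _ "\<lambda>s. g s + h s"]) (auto simp: distrib_right)
qed

lemma mild_poles_mult:
  assumes F: "mild_poles \<Lambda> F U" and h: "open U" "\<And>s. s \<in> U \<Longrightarrow> cdiff h s"
  shows "mild_poles \<Lambda> (\<lambda>s. h s * F s) U"
  unfolding mild_poles_def
proof
  fix a assume a: "a \<in> U"
  obtain V g where V: "open V" "a \<in> V" "\<And>s. s \<in> V \<Longrightarrow> cdiff g s"
    "\<And>s. s \<in> V \<Longrightarrow> s \<in> off_hyperplanes polar_forms \<Longrightarrow> F s * (\<Prod>l | l \<in> \<Lambda> \<and> l a = 0. l s) = g s"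
    using mild_polesE[OF F a] by blast
  show "\<exists>V g. open V \<and> a \<in> V \<and> (\<forall>s\<in>V. cdiff g s) \<and>
     (\<forall>s \<in> V \<inter> off_hyperplanes polar_forms. (h s * F s) * (\<Prod>l | l \<in> \<Lambda> \<and> l a = 0. l s) = g s)"
    using V h a by (intro exI[of _ "V \<inter> U"] exI[of _ "\<lambda>s. h s * g s"]) (auto simp: mult.assoc)
qed

text \<open>The additional forms vanishing at \<open>a\<close> are holomorphic and can be multiplied
  into \<open>g\<close>.\<close>

lemma mild_poles_superset:
  assumes F: "mild_poles \<Lambda> F U" and sub: "\<Lambda> \<subseteq> \<Lambda>'" "\<Lambda>' \<subseteq> polar_forms"
  shows "mild_poles \<Lambda>' F U"
  unfolding mild_poles_def
proof
  fix a assume a: "a \<in> U"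
  obtain V g where V: "open V" "a \<in> V" "\<And>s. s \<in> V \<Longrightarrow> cdiff g s"
    "\<And>s. s \<in> V \<Longrightarrow> s \<in> off_hyperplanes polar_forms \<Longrightarrow> F s * (\<Prod>l | l \<in> \<Lambda> \<and> l a = 0. l s) = g s"
    using mild_polesE[OF F a] by blast
  define D where "D = {l \<in> \<Lambda>'. l a = 0} - {l \<in> \<Lambda>. l a = 0}"
  have D: "(\<Prod>l | l \<in> \<Lambda>' \<and> l a = 0. l s) = (\<Prod>l\<in>D. l s) * (\<Prod>l | l \<in> \<Lambda> \<and> l a = 0. l s)" for s
    unfolding D_def using sub by (intro prod.subset_diff finite_vanishing_subset) auto
  have "cdiff (\<lambda>s. (\<Prod>l\<in>D. l s) * g s) s" if "s \<in> V" for s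
    using that V(3) sub by (intro cdiff_mult cdiff_prod) (auto simp: D_def intro: cdiff_polar_form)
  then show "\<exists>V g. open V \<and> a \<in> V \<and> (\<forall>s\<in>V. cdiff g s) \<and>
     (\<forall>s \<in> V \<inter> off_hyperplanes polar_forms. F s * (\<Prod>l | l \<in> \<Lambda>' \<and> l a = 0. l s) = g s)"
    using V by (intro exI[of _ V] exI[of _ "\<lambda>s. (\<Prod>l\<in>D. l s) * g s"]) (auto simp: D)
qed

lemma mild_poles_holomorphic:
  assumes "open U" "\<And>s. s \<in> U \<Longrightarrow> cdiff h s" "\<Lambda> \<subseteq> polar_forms"
  shows "mild_poles \<Lambda> h U"
proof -
  have "mild_poles {} h U" using assms unfolding mild_poles_def by auto
  then show ?thesis by (rule mild_poles_superset) (use assms(3) in auto)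
qed

lemma mild_poles_sum:
  assumes "\<And>i. i \<in> I \<Longrightarrow> mild_poles \<Lambda> (F i) U" "open U" "\<Lambda> \<subseteq> polar_forms"
  shows "mild_poles \<Lambda> (\<lambda>s. \<Sum>i\<in>I. F i s) U"
  using assms
proof (induction I rule: infinite_finite_induct)
  case (insert i I)
  then show ?case by (simp add: mild_poles_add)
qed (auto intro!: mild_poles_holomorphic)

text \<open>Where \<open>l\<close> vanishes, the division is undone by the factor \<open>l\<close>
  of the enlarged product, a new factor because \<open>l \<notin> \<Lambda>\<close>; elsewhere
  \<open>1 / l\<close> is holomorphic. This keeps the poles simple.\<close>

lemma mild_poles_divide:
  assumes F: "mild_poles \<Lambda> F U" and l: "l \<notin> \<Lambda>" "insert l \<Lambda> \<subseteq> \<Lambda>'" "\<Lambda>' \<subseteq> polar_forms"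
  shows "mild_poles \<Lambda>' (\<lambda>s. F s / l s) U"
proof -
  have "mild_poles (insert l \<Lambda>) (\<lambda>s. F s / l s) U"
    unfolding mild_poles_def
  proof
    fix a assume a: "a \<in> U"
    obtain V g where V: "open V" "a \<in> V" "\<And>s. s \<in> V \<Longrightarrow> cdiff g s"
      "\<And>s. s \<in> V \<Longrightarrow> s \<in> off_hyperplanes polar_forms \<Longrightarrow> F s * (\<Prod>l | l \<in> \<Lambda> \<and> l a = 0. l s) = g s"
      using mild_polesE[OF F a] by blast
    have lp: "l \<in> polar_forms" using l by blast
    have off: "l s \<noteq> 0" if "s \<in> off_hyperplanes polar_forms" for s
      using that lp by (auto simp: off_hyperplanes_def)
    have fin: "finite {l \<in> \<Lambda>. l a = 0}" using l by (intro finite_vanishing_subset) auto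
    show "\<exists>V g. open V \<and> a \<in> V \<and> (\<forall>s\<in>V. cdiff g s) \<and>
     (\<forall>s \<in> V \<inter> off_hyperplanes polar_forms. F s / l s * (\<Prod>l' | l' \<in> insert l \<Lambda> \<and> l' a = 0. l' s) = g s)"
    proof (cases "l a = 0")
      case True
      then have "{l'. l' \<in> insert l \<Lambda> \<and> l' a = 0} = insert l {l' \<in> \<Lambda>. l' a = 0}" by auto
      then have "(\<Prod>l' | l' \<in> insert l \<Lambda> \<and> l' a = 0. l' s) = l s * (\<Prod>l | l \<in> \<Lambda> \<and> l a = 0. l s)" for s
        using fin l(1) by simp
      then show ?thesis using V off by (intro exI[of _ V] exI[of _ g]) auto
    next
      case False
      then have "{l'. l' \<in> insert l \<Lambda> \<and> l' a = 0} = {l' \<in> \<Lambda>. l' a = 0}" by auto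
      then have eq: "(\<Prod>l' | l' \<in> insert l \<Lambda> \<and> l' a = 0. l' s) = (\<Prod>l | l \<in> \<Lambda> \<and> l a = 0. l s)" for s
        by simp
      obtain W where W: "open W" "a \<in> W" "\<And>s. s \<in> W \<Longrightarrow> l s \<in> - {0}"
        by (rule cdiff_open_nhd[of l a "- {0}"]) (use False cdiff_polar_form[OF lp] in auto)
      have "cdiff (\<lambda>s. inverse (l s) * g s) s" if "s \<in> V \<inter> W" for s
        using that V W cdiff_polar_form[OF lp] by (intro cdiff_mult cdiff_inverse) auto
      moreover have "F s / l s * (\<Prod>l | l \<in> \<Lambda> \<and> l a = 0. l s) = inverse (l s) * g s"
        if "s \<in> V \<inter> W" "s \<in> off_hyperplanes polar_forms" for s
        using V(4)[of s] that by (simp add: divide_inverse mult.assoc mult.left_commute)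
      ultimately show ?thesis using V(1,2) W(1,2) unfolding eq
        by (intro exI[of _ "V \<inter> W"] exI[of _ "\<lambda>s. inverse (l s) * g s"]) blast
    qed
  qed
  then show ?thesis using l(2,3) by (rule mild_poles_superset)
qed

text \<open>At such a point the product is empty, so \<open>F\<close> itself agrees with
  \<open>g\<close> nearby, the complement of all the hyperplanes being open.\<close>

lemma mild_poles_cdiff:
  assumes F: "mild_poles \<Lambda> F U" and sub: "\<Lambda> \<subseteq> polar_forms" and a: "a \<in> U" "a \<in> off_hyperplanes polar_forms"
  shows "cdiff F a"
proof -
  obtain V g where V: "open V" "a \<in> V" "\<And>s. s \<in> V \<Longrightarrow> cdiff g s"
    "\<And>s. s \<in> V \<Longrightarrow> s \<in> off_hyperplanes polar_forms \<Longrightarrow> F s * (\<Prod>l | l \<in> \<Lambda> \<and> l a = 0. l s) = g s"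
    using mild_polesE[OF F a(1)] by blast
  have e: "{l. l \<in> \<Lambda> \<and> l a = 0} = {}" using a sub by (auto simp: off_hyperplanes_def)
  then have "g s = F s" if "s \<in> V \<inter> off_hyperplanes polar_forms" for s
    using V(4)[of s] that unfolding e by simp
  moreover have "open (V \<inter> off_hyperplanes polar_forms)" using V open_off_hyperplanes by auto
  ultimately show ?thesis
    using V(2) a(2) by (intro cdiff_eventually_cong[OF V(3)[OF V(2)], of "V \<inter> off_hyperplanes polar_forms"]) auto
qed

section \<open>Tails of the index set, and half spaces\<close>

definition tail_from :: "'r::{finite,linorder} \<Rightarrow> 'r list \<Rightarrow> bool" where
  "tail_from i is \<longleftrightarrow> sorted_wrt (<) (i # is) \<and> set (i # is) = {i..}"

lemma tail_from_Cons:
  assumes "tail_from i (j # js)"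
  shows "tail_from j js" "{..j} = insert j {..i}" "j \<notin> {..i}" "i < j" "position j = Suc (position i)"
    "partial_sum s j = partial_sum s i + s $ j"
proof -
  have set: "insert i (insert j (set js)) = {i..}" and lt: "i < j" "\<forall>k\<in>set js. j < k"
    using assms by (auto simp: tail_from_def)
  have mem: "k = i \<or> k = j \<or> j < k" if "i \<le> k" for k
    using that set lt by (metis atLeast_iff insert_iff)
  have "insert j (set js) = {j..}"
  proof -
    have "k \<in> set js" if "j < k" for k
      using that set lt by (metis atLeast_iff insert_iff less_imp_le less_irrefl order.strict_trans)
    then show ?thesis using lt(2) by (auto simp: le_less)
  qed
  then show "tail_from j js" using assms by (simp add: tail_from_def)
  show I: "{..j} = insert j {..i}" using mem lt(1) by (auto simp: not_le) (metis leD leI less_imp_le)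
  show N: "j \<notin> {..i}" and "i < j" using lt by auto
  show "position j = Suc (position i)" unfolding position_def I using N by simp
  show "partial_sum s j = partial_sum s i + s $ j"
    unfolding partial_sum_def I using N by simp
qed

text \<open>Each entry \<open>j\<close> adds \<open>Re (s $ j) - 1\<close>, and these add up to
  differences of partial sums and of positions. For the least index and
  \<open>y = Re (s $ i)\<close> the condition becomes membership in \<open>L_domain\<close>.\<close>

lemma conv_tail_iff:
  "tail_from i is \<Longrightarrow> conv (\<lambda>i. Re (s $ i)) y is \<longleftrightarrow>
    (\<forall>j\<ge>i. y + Re (partial_sum s j) - Re (partial_sum s i) - (real (position j) - real (position i)) > 1)"
proof (induction "is" arbitrary: i y)
  case Nil
  then have "{i..} = {i}" by (simp add: tail_from_def)
  then have "j \<ge> i \<longleftrightarrow> j = i" for j by auto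
  then show ?case by simp
next
  case (Cons j js)
  note t = tail_from_Cons[OF Cons.prems]
  have "k \<ge> i \<longleftrightarrow> k = i \<or> k \<ge> j" for k
    using t(2,4) by (metis atMost_iff insertCI insertE linear nle_le order.strict_implies_order order.trans)
  then have "(\<forall>k\<ge>i. P k) \<longleftrightarrow> P i \<and> (\<forall>k\<ge>j. P k)" for P :: "'a \<Rightarrow> bool" by auto
  then show ?case
    unfolding conv.simps Cons.IH[OF t(1)] by (simp add: t(5,6) algebra_simps)
qed

definition half_space :: "nat \<Rightarrow> (complex ^ 'r::{finite,linorder}) set" where
  "half_space B = {s. \<forall>i. Re (partial_sum s i) > - real B}"

lemma open_half_space: "open (half_space B :: (complex ^ 'r::{finite,linorder}) set)"
proof -
  have "half_space B = (\<Inter>i. (\<lambda>s::complex ^ 'r::{finite,linorder}. partial_sum s i) -` {z. Re z > - real B})" by (auto simp: half_space_def)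
  moreover have "open ((\<lambda>s. partial_sum s i) -` {z. Re z > - real B})" for i :: 'r
    by (intro open_vimage continuous_partial_sum open_halfspace_Re_gt)
  ultimately show ?thesis by (simp add: open_INT)
qed

lemma position_le: "position (i :: 'r::{finite,linorder}) \<le> CARD('r)"
  unfolding position_def by (rule card_mono) auto

text \<open>The partial sum at \<open>i\<close> cancels, leaving that at \<open>j\<close>,
  \<open>K - c\<close> and a difference of positions. The summands \<open>B\<close>,
  \<open>nat \<bar>c\<bar>\<close> and \<open>CARD('r)\<close> of \<open>K\<close> outweigh the
  possible losses, and the final 2 keeps the total above 1.\<close>

lemma half_space_conv:
  fixes s :: "complex ^ 'r::{finite,linorder}"
  assumes "s \<in> half_space B" "tail_from i is" "K \<ge> B + nat \<bar>c\<bar> + CARD('r) + 2"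
  shows "conv (\<lambda>i. Re (s $ i)) (Re (partial_sum s i - of_int c + of_nat K)) is"
  unfolding conv_tail_iff[OF assms(2)]
proof (intro allI impI)
  fix j
  have "Re (partial_sum s j) > - real B" using assms by (simp add: half_space_def)
  moreover have "real (position j) \<le> real CARD('r)" using position_le[of j] by simp
  moreover have "real K \<ge> real B + \<bar>of_int c\<bar> + real CARD('r) + 2"
    using assms(3) by linarith
  ultimately show "1 < Re (partial_sum s i - of_int c + of_nat K) + Re (partial_sum s j) - Re (partial_sum s i)
      - (real (position j) - real (position i))"
    by simp
qed

lemma conv_tail_step:
  assumes "tail_from i (j # js)" "conv (\<lambda>i. Re (s $ i)) (Re (partial_sum s i - of_int c)) (j # js)"
  shows "conv (\<lambda>i. Re (s $ i)) (Re (partial_sum s j - of_int (c + 1 - int k))) js"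
    and "conv (\<lambda>i. Re (s $ i)) (Re (partial_sum s j - of_int c)) js"
  using assms(2) tail_from_Cons(6)[OF assms(1), of s]
  by (auto elim!: conv_mono)

text \<open>Forms are compared as functions: the value at 0 identifies the integer, and the unit
  vector at \<open>k > i\<close> separates the partial sums.\<close>

lemma polar_form_notin:
  assumes "i < j"
  shows "(\<lambda>s. partial_sum s i - of_int n) \<notin> polar_forms_from j"
proof
  assume "(\<lambda>s. partial_sum s i - of_int n) \<in> polar_forms_from j"
  then obtain k m where k: "j \<le> k" "(\<lambda>s. partial_sum s i - of_int n) = (\<lambda>s. partial_sum s k - of_int m)"
    by (auto simp: polar_forms_from_def)
  from fun_cong[OF k(2), of 0] have "n = m" by (simp add: partial_sum_def)
  moreover have "partial_sum (axis k 1) i = 0" "partial_sum (axis k 1) k = 1"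
    using assms k(1) by (auto simp: partial_sum_def axis_def)
  ultimately show False using fun_cong[OF k(2), of "axis k 1"] by simp
qed

section \<open>Continuation of nested series\<close>

text \<open>\<open>F\<close> depends on \<open>B\<close> through the order \<open>K\<close>. The
  condition on \<open>c + 1\<close> says that the hyperplane where the leading exponent equals 1 is
  a permitted one; \<open>f\<close> and \<open>c\<close> stay general because the shorter series
  bring new coefficients and shifts.\<close>

lemma nested_series_continuation:
  fixes chi :: "'r::{finite,linorder} \<Rightarrow> nat \<Rightarrow> complex"
  assumes q: "q > 0" and chi_periodic: "\<And>i. periodic q (chi i)" and chi: "\<And>i n. norm (chi i n) \<le> M"
  shows "tail_from i is \<Longrightarrow> periodic q f \<Longrightarrow> polar_index i (c + 1) \<Longrightarrow>
    \<exists>F. (\<forall>s. conv (\<lambda>i. Re (s $ i)) (Re (partial_sum s i - of_int c)) is \<longrightarrow>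
              F s = nested_series_value chi is f (partial_sum s i - of_int c) s) \<and>
        mild_poles (polar_forms_from i) F (half_space B)"
proof (induction "is" arbitrary: i f c)
  case Nil
  \<comment> \<open>The size demanded by \<open>half_space_conv\<close>, so that the remainder
    converges on \<open>half_space B\<close>.\<close>
  define K where "K = B + nat \<bar>c\<bar> + CARD('r) + 2"
  have K: "K \<ge> 1" by (simp add: K_def)
  obtain \<phi> where \<phi>: "\<And>k. k \<le> K \<Longrightarrow> periodic q (\<phi> k)" and small: "EM_error_small f \<phi> K"
    using Euler_Maclaurin[OF q Nil.prems(2) K] by blast
  have \<phi>b: "\<exists>B. \<forall>n. norm (\<phi> k n) \<le> B" if "k \<le> K" for k
    using periodic_bounded[OF q \<phi>[OF that]] by metis
  obtain Mf where Mf: "\<And>n. norm (f n) \<le> Mf" using periodic_bounded[OF q Nil.prems(2)] by metis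
  define w where "w = (\<lambda>s::complex ^ 'r::{finite,linorder}. partial_sum s i - of_int c)"
  define l where "l = (\<lambda>s::complex ^ 'r::{finite,linorder}. partial_sum s i - of_int (c + 1))"
  have wl: "1 - w s = - l s" for s by (simp add: w_def l_def)
  have w: "cdiff w s" for s unfolding w_def by (intro cdiff_diff cdiff_partial_sum cdiff_const)
  have l: "l \<in> polar_forms_from i" using Nil.prems(3) unfolding l_def polar_forms_from_def by blast
  define R where "R s = EM_remainder chi [] f \<phi> K (1 - w s) s" for s
  have R: "cdiff R s" if "s \<in> half_space B" for s
    unfolding R_def EM_remainder_def
    by (rule nested_series(3)[where chi = chi, OF dominated_EM_error[OF w small] chi])
      (unfold w_def, rule half_space_conv[OF that Nil.prems(1)], simp add: K_def)
  define F where "F s = R s / l s" for s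
  have "mild_poles (polar_forms_from i) F (half_space B)"
    unfolding F_def
    by (rule mild_poles_divide[of "{}"])
      (use R l polar_forms_from_subset open_half_space in \<open>auto intro!: mild_poles_holomorphic\<close>)
  moreover have "F s = nested_series_value chi [] f (w s) s" if "conv (\<lambda>i. Re (s $ i)) (Re (w s)) []" for s
  proof -
    have "l s \<noteq> 0" using that by (auto simp: l_def w_def)
    then show ?thesis
      using EM_nested_Nil[where chi = chi, OF chi Mf \<phi>b small that] by (simp add: wl F_def R_def nonzero_divide_eq_eq mult.commute)
  qed
  ultimately show ?case unfolding w_def by blast
next
  case (Cons j js)
  note t = tail_from_Cons[OF Cons.prems(1)]
  define K where "K = B + nat \<bar>c\<bar> + CARD('r) + 2"
  have K: "K \<ge> 1" by (simp add: K_def)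
  obtain \<phi> where \<phi>: "\<And>k. k \<le> K \<Longrightarrow> periodic q (\<phi> k)" and small: "EM_error_small f \<phi> K"
    using Euler_Maclaurin[OF q Cons.prems(2) K] by blast
  have \<phi>b: "\<exists>B. \<forall>n. norm (\<phi> k n) \<le> B" if "k \<le> K" for k
    using periodic_bounded[OF q \<phi>[OF that]] by metis
  obtain Mf where Mf: "\<And>n. norm (f n) \<le> Mf" using periodic_bounded[OF q Cons.prems(2)] by metis
  define w where "w = (\<lambda>s::complex ^ 'r::{finite,linorder}. partial_sum s i - of_int c)"
  define l where "l = (\<lambda>s::complex ^ 'r::{finite,linorder}. partial_sum s i - of_int (c + 1))"
  have wl: "1 - w s = - l s" for s by (simp add: w_def l_def)
  have w: "cdiff w s" for s unfolding w_def by (intro cdiff_diff cdiff_partial_sum cdiff_const)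
  have l: "l \<in> polar_forms_from i" using Cons.prems(3) unfolding l_def polar_forms_from_def by blast
  have ws: "w s - 1 + of_nat k + s $ j = partial_sum s j - of_int (c + 1 - int k)"
    "w s + s $ j = partial_sum s j - of_int c" for s k
    by (simp_all add: w_def t(6))
  define R where "R s = EM_remainder' chi j js f \<phi> K (1 - w s) s + EM_remainder chi (j # js) f \<phi> K (1 - w s) s" for s
  have R: "cdiff R s" if s: "s \<in> half_space B" for s
    unfolding R_def EM_remainder_def EM_remainder'_def
  proof (intro cdiff_add)
    have c: "conv (\<lambda>i. Re (s $ i)) (Re (w s + of_nat K)) (j # js)"
      unfolding w_def by (rule half_space_conv[OF s Cons.prems(1)]) (simp add: K_def)
    show "cdiff (\<lambda>s. \<Sum>n. EM_error f \<phi> K (1 - w s) n * nested_sum (dirichlet_term chi s) (j # js) n) s"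
      by (rule nested_series(3)[where chi = chi, OF dominated_EM_error[OF w small] chi c])
    show "cdiff (\<lambda>s. \<Sum>n. EM_error f \<phi> K (1 - w s) n * (chi j n * of_nat n powr - s $ j) * nested_sum (dirichlet_term chi s) js n) s"
      by (rule nested_series(3)[where chi = chi, OF dominated_EM_error'[where chi = chi, OF chi w small] chi])
        (use c in \<open>auto elim!: conv_mono\<close>)
  qed
  \<comment> \<open>Since \<open>c + 1\<close> is at most \<open>position i\<close>, and
    \<open>position j\<close> is one larger and thus at least 2, every \<open>k\<close> yields an
    integer at most \<open>position j\<close>.\<close>
  have p: "polar_index j (c + 1 - int k + 1)" "polar_index j (c + 1)" for k
    using Cons.prems(3) t(5) by (auto simp: polar_index_def)
  have per: "periodic q (\<lambda>n. \<phi> k n * chi j n)" if "k \<le> K" for k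
    using \<phi>[OF that] chi_periodic by (simp add: periodic_def)
  define cont where "cont k F \<longleftrightarrow>
      (\<forall>s. conv (\<lambda>i. Re (s $ i)) (Re (partial_sum s j - of_int (c + 1 - int k))) js \<longrightarrow>
        F s = nested_series_value chi js (\<lambda>n. \<phi> k n * chi j n) (partial_sum s j - of_int (c + 1 - int k)) s) \<and>
      mild_poles (polar_forms_from j) F (half_space B)" for k F
  have "\<exists>F. k \<le> K \<longrightarrow> cont k F" for k
    unfolding cont_def using Cons.IH[OF t(1) per p(1)] by blast
  then obtain G where cont: "\<And>k. k \<le> K \<Longrightarrow> cont k (G k)" by metis
  have G: "G k s = nested_series_value chi js (\<lambda>n. \<phi> k n * chi j n) (partial_sum s j - of_int (c + 1 - int k)) s"
    if "k \<le> K" "conv (\<lambda>i. Re (s $ i)) (Re (partial_sum s j - of_int (c + 1 - int k))) js" for k s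
    using cont[OF that(1)] that(2) unfolding cont_def by blast
  have G_mild: "mild_poles (polar_forms_from j) (G k) (half_space B)" if "k \<le> K" for k
    using cont[OF that] unfolding cont_def by blast
  have "periodic q (\<lambda>n. f n * chi j n)"
    using Cons.prems(2) chi_periodic by (simp add: periodic_def)
  from Cons.IH[OF t(1) this p(2)] obtain H where
    H: "\<And>s. conv (\<lambda>i. Re (s $ i)) (Re (partial_sum s j - of_int c)) js \<Longrightarrow>
              H s = nested_series_value chi js (\<lambda>n. f n * chi j n) (partial_sum s j - of_int c) s"
    "mild_poles (polar_forms_from j) H (half_space B)"
    by blast
  define T where "T s = (\<Sum>k\<le>K. falling k (1 - w s) * G k s) + (1 - w s) * H s + R s" for s
  define F where "F s = T s / l s" for s
  have "mild_poles (polar_forms_from j) T (half_space B)"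
    unfolding T_def
    by (intro mild_poles_add mild_poles_sum mild_poles_mult mild_poles_holomorphic open_half_space
        polar_forms_from_subset G_mild H R cdiff_falling cdiff_diff cdiff_const w) auto
  then have "mild_poles (polar_forms_from i) F (half_space B)"
    unfolding F_def
  proof (rule mild_poles_divide)
    show "l \<notin> polar_forms_from j" unfolding l_def using t(4) by (rule polar_form_notin)
    show "insert l (polar_forms_from j) \<subseteq> polar_forms_from i"
      using l polar_forms_from_mono[of i j] t(4) by auto
  qed (rule polar_forms_from_subset)
  moreover have "F s = nested_series_value chi (j # js) f (w s) s"
    if cv: "conv (\<lambda>i. Re (s $ i)) (Re (w s)) (j # js)" for s
  proof -
    have "l s \<noteq> 0" using cv by (auto simp: l_def w_def)
    moreover have "(1 - w s) * nested_series_value chi (j # js) f (w s) s = - T s"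
    proof -
      note c = conv_tail_step[OF Cons.prems(1) cv[unfolded w_def]]
      have "(\<Sum>k\<le>K. falling k (1 - w s) * nested_series_value chi js (\<lambda>n. \<phi> k n * chi j n) (w s - 1 + of_nat k + s $ j) s)
          = (\<Sum>k\<le>K. falling k (1 - w s) * G k s)"
        unfolding ws by (intro sum.cong) (auto simp: G[OF _ c(1)])
      then show ?thesis
        using EM_nested_Cons[where chi = chi, OF chi Mf \<phi>b small cv] H(1)[OF c(2)]
        by (simp only: T_def R_def ws add.assoc)
    qed
    ultimately show ?thesis by (simp add: wl F_def nonzero_divide_eq_eq mult.commute)
  qed
  ultimately show ?case unfolding w_def by blast
qed

section \<open>The multiple L-function\<close>

text \<open>Tuples vanish outside the list, so that they form a finite set and a shorter list
  amounts to resetting one coordinate to 0. Indices increase while values decrease, so the head of a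
  sorted list carries the largest value.\<close>

definition chain_tuples :: "'r::linorder list \<Rightarrow> nat \<Rightarrow> ('r \<Rightarrow> nat) set" where
  "chain_tuples is m = {n. (\<forall>i\<in>set is. 0 < n i \<and> n i < m) \<and>
     (\<forall>i\<in>set is. \<forall>j\<in>set is. i < j \<longrightarrow> n j < n i) \<and> (\<forall>i. i \<notin> set is \<longrightarrow> n i = 0)}"

lemma chain_tuples_Cons:
  assumes "sorted_wrt (<) (i # is)"
  shows "chain_tuples (i # is) m = (\<lambda>(k, h). h(i := k)) ` Sigma {1..<m} (chain_tuples is)"
    (is "?L = ?R")
proof
  have lt: "i < j" if "j \<in> set is" for j using assms that by simp
  show "?L \<subseteq> ?R"
  proof
    fix n assume n: "n \<in> ?L"
    have "n(i := 0) \<in> chain_tuples is (n i)"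
      using n lt by (auto simp: chain_tuples_def)
    moreover have "n i \<in> {1..<m}" using n by (auto simp: chain_tuples_def)
    ultimately show "n \<in> ?R" by (intro image_eqI[of _ _ "(n i, n(i := 0))"]) auto
  qed
  show "?R \<subseteq> ?L"
  proof
    fix n assume "n \<in> ?R"
    then obtain k h where n: "n = h(i := k)" and k: "1 \<le> k" "k < m" and h: "h \<in> chain_tuples is k"
      by auto
    have h1: "0 < h j \<and> h j < k" if "j \<in> set is" for j using h that by (simp add: chain_tuples_def)
    have h2: "h j' < h j" if "j \<in> set is" "j' \<in> set is" "j < j'" for j j'
      using h that by (simp add: chain_tuples_def)
    have h3: "h j = 0" if "j \<notin> set is" for j using h that by (simp add: chain_tuples_def)
    have "0 < n j \<and> n j < m" if "j \<in> set (i # is)" for j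
      using h1[of j] k that by (auto simp: n)
    moreover have "n j' < n j" if jj: "j \<in> set (i # is)" "j' \<in> set (i # is)" "j < j'" for j j'
    proof -
      have "j' \<noteq> i" using lt[of j] jj by auto
      then show ?thesis using h1[of j'] h2[of j j'] jj by (auto simp: n)
    qed
    moreover have "n j = 0" if "j \<notin> set (i # is)" for j
      using h3[of j] that by (simp add: n)
    ultimately show "n \<in> ?L" by (simp add: chain_tuples_def)
  qed
qed

text \<open>The condition \<open>t i 0 = 0\<close> reconciles nested sums, which start at 0, with
  tuples of positive integers.\<close>

lemma sum_chain_tuples:
  fixes t :: "'r::linorder \<Rightarrow> nat \<Rightarrow> 'a::comm_semiring_1"
  assumes t0: "\<And>i. t i 0 = 0"
  shows "sorted_wrt (<) is \<Longrightarrow> finite (chain_tuples is m) \<and>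
    (\<Sum>n\<in>chain_tuples is m. \<Prod>i\<in>set is. t i (n i)) = nested_sum t is m"
proof (induction "is" arbitrary: m)
  case Nil
  have "chain_tuples ([] :: 'r list) m = {\<lambda>_. 0}" by (auto simp: chain_tuples_def)
  then show ?case by simp
next
  case (Cons i "is")
  have fin: "finite (chain_tuples is k)"
    and sum: "(\<Sum>n\<in>chain_tuples is k. \<Prod>i\<in>set is. t i (n i)) = nested_sum t is k" for k
    using Cons by auto
  have i: "i \<notin> set is" using Cons.prems by auto
  have inj: "inj_on (\<lambda>(k, h). h(i := k)) (Sigma {1..<m} (chain_tuples is))"
  proof (rule inj_onI, clarify)
    fix k h k' h' assume h: "h \<in> chain_tuples is k" "h' \<in> chain_tuples is k'" and eq: "h(i := k) = h'(i := k')"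
    have "h i = 0" "h' i = 0" using h i by (auto simp: chain_tuples_def)
    then have "h j = h' j" for j using fun_cong[OF eq, of j] by (cases "j = i") auto
    then show "k = k' \<and> h = h'" using fun_cong[OF eq, of i] by auto
  qed
  have prod: "(\<Prod>j\<in>set (i # is). t j ((h(i := k)) j)) = t i k * (\<Prod>j\<in>set is. t j (h j))" for h k
  proof -
    have "(\<Prod>j\<in>set is. t j ((h(i := k)) j)) = (\<Prod>j\<in>set is. t j (h j))"
      using i by (intro prod.cong) auto
    then show ?thesis using i by simp
  qed
  have "(\<Sum>n\<in>chain_tuples (i # is) m. \<Prod>j\<in>set (i # is). t j (n j))
      = (\<Sum>(k, h)\<in>Sigma {1..<m} (chain_tuples is). t i k * (\<Prod>j\<in>set is. t j (h j)))"
    unfolding chain_tuples_Cons[OF Cons.prems] sum.reindex[OF inj]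
    by (intro sum.cong refl) (simp only: comp_def case_prod_beta prod)
  also have "\<dots> = (\<Sum>k\<in>{1..<m}. \<Sum>h\<in>chain_tuples is k. t i k * (\<Prod>j\<in>set is. t j (h j)))"
    by (subst sum.Sigma) (auto intro: fin)
  also have "\<dots> = (\<Sum>k\<in>{1..<m}. t i k * nested_sum t is k)"
    by (simp add: sum_distrib_left[symmetric] sum)
  also have "\<dots> = (\<Sum>k<m. t i k * nested_sum t is k)"
    by (rule sum.mono_neutral_left) (auto simp: t0 not_le)
  finally show ?case
    unfolding chain_tuples_Cons[OF Cons.prems] using fin by auto
qed

lemma L_term_eq: "L_term chi s n = (\<Prod>i\<in>UNIV. dirichlet_term chi s i (n i))"
  unfolding L_term_def dirichlet_term_def prod_dividef[symmetric]
  by (simp add: powr_minus divide_inverse)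

lemma chain_tuples_UNIV_subset:
  "set is = UNIV \<Longrightarrow> chain_tuples is m \<subseteq> decreasing_tuples"
  by (auto simp: chain_tuples_def decreasing_tuples_def)

lemma finite_subset_chain_tuples:
  assumes "set is = (UNIV :: 'r::{finite,linorder} set)" "finite X" "X \<subseteq> decreasing_tuples"
  shows "\<forall>\<^sub>F m in sequentially. X \<subseteq> chain_tuples is m"
proof -
  have "\<forall>\<^sub>F m in sequentially. \<forall>n\<in>X. \<forall>i\<in>UNIV. n i < m"
    using assms(2) by (intro eventually_ball_finite ballI eventually_gt_at_top) auto
  then show ?thesis
  proof eventually_elim
    case (elim m)
    then show ?case using assms(1,3) by (auto simp: chain_tuples_def decreasing_tuples_def)
  qed
qed

text \<open>Every finite set of tuples lies in some \<open>chain_tuples\<close>, whose sum of norms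
  is a partial sum of a convergent series; this gives absolute summability. As these sets exhaust
  the tuples, the unordered sum is the limit along them.\<close>

lemma multiple_L_eq_nested:
  fixes chi :: "'r::{finite,linorder} \<Rightarrow> nat \<Rightarrow> complex"
  assumes L: "sorted_wrt (<) (i # is)" "set (i # is) = (UNIV :: 'r set)" and chi: "\<And>i n. norm (chi i n) \<le> M"
    and conv: "conv (\<lambda>i. Re (s $ i)) (Re (s $ i)) is"
  shows "L_term chi s summable_on decreasing_tuples"
    and "multiple_L chi s = nested_series_value chi is (chi i) (s $ i) s"
proof -
  let ?t = "dirichlet_term chi s" and ?T = "\<lambda>i n. norm (dirichlet_term chi s i n)"
  have dom: "dominated (\<lambda>n u. chi i n * of_nat n powr (- (s $ i))) (\<lambda>_. s $ i)"
    by (rule dominated_nat_powr[OF cdiff_const chi])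
  have t0: "?t i 0 = 0" "?T i 0 = 0" for i by (auto simp: dirichlet_term_def)
  have sm: "summable (\<lambda>n. ?T i n * nested_sum ?T is n)"
    using nested_series(1)[where chi = chi, OF dom chi conv] unfolding dirichlet_term_def .
  have bound: "sum (\<lambda>n. norm (L_term chi s n)) X \<le> (\<Sum>n. ?T i n * nested_sum ?T is n)"
    if X: "finite X" "X \<subseteq> decreasing_tuples" for X
  proof -
    obtain m where m: "X \<subseteq> chain_tuples (i # is) m"
      using eventually_happens'[OF sequentially_bot finite_subset_chain_tuples[OF L(2) X]] by blast
    note fs = sum_chain_tuples[of ?T, OF t0(2) L(1), of m]
    have "sum (\<lambda>n. norm (L_term chi s n)) X \<le> sum (\<lambda>n. norm (L_term chi s n)) (chain_tuples (i # is) m)"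
      using m fs by (intro sum_mono2) auto
    also have "\<dots> = (\<Sum>n<m. ?T i n * nested_sum ?T is n)"
      using fs by (simp add: L_term_eq prod_norm L(2)[simplified])
    also have "\<dots> \<le> (\<Sum>n. ?T i n * nested_sum ?T is n)"
      by (rule sum_le_suminf[OF sm]) (auto intro!: mult_nonneg_nonneg nested_sum_nonneg)
    finally show ?thesis .
  qed
  have "(\<lambda>n. norm (L_term chi s n)) summable_on decreasing_tuples"
    by (rule nonneg_bdd_above_summable_on) (auto intro!: bdd_aboveI2 bound)
  then show summ: "L_term chi s summable_on decreasing_tuples"
    by (rule abs_summable_summable)
  then have "(L_term chi s has_sum multiple_L chi s) decreasing_tuples"
    unfolding multiple_L_def by (rule has_sum_infsum)
  then have "(sum (L_term chi s) \<longlongrightarrow> multiple_L chi s) (finite_subsets_at_top decreasing_tuples)"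
    by (simp add: has_sum_def)
  moreover have "filterlim (chain_tuples (i # is)) (finite_subsets_at_top decreasing_tuples) sequentially"
    unfolding filterlim_finite_subsets_at_top
  proof (intro allI impI)
    fix X :: "('r \<Rightarrow> nat) set" assume "finite X \<and> X \<subseteq> decreasing_tuples"
    then have "\<forall>\<^sub>F m in sequentially. X \<subseteq> chain_tuples (i # is) m"
      using finite_subset_chain_tuples[OF L(2)] by blast
    then show "\<forall>\<^sub>F m in sequentially. finite (chain_tuples (i # is) m) \<and> X \<subseteq> chain_tuples (i # is) m \<and>
        chain_tuples (i # is) m \<subseteq> decreasing_tuples"
      by eventually_elim (use sum_chain_tuples[of ?t, OF t0(1) L(1)] chain_tuples_UNIV_subset[OF L(2)] in blast)
  qed
  ultimately have "(\<lambda>m. sum (L_term chi s) (chain_tuples (i # is) m)) \<longlonglongrightarrow> multiple_L chi s"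
    by (rule filterlim_compose)
  moreover have "sum (L_term chi s) (chain_tuples (i # is) m) = (\<Sum>n<m. ?t i n * nested_sum ?t is n)" for m
    using sum_chain_tuples[of ?t, OF t0(1) L(1), of m] by (simp add: L_term_eq L(2)[simplified])
  moreover have "(\<lambda>m. \<Sum>n<m. ?t i n * nested_sum ?t is n) \<longlonglongrightarrow> nested_series_value chi is (chi i) (s $ i) s"
    using nested_series_value_sums[where chi = chi and f = "chi i", OF chi chi conv]
    unfolding sums_def dirichlet_term_def .
  ultimately show "multiple_L chi s = nested_series_value chi is (chi i) (s $ i) s"
    using LIMSEQ_unique by simp
qed

section \<open>Uniqueness of the continuations on half spaces\<close>

lemma half_space_mono: "B \<le> B' \<Longrightarrow> half_space B \<subseteq> half_space B'"
  unfolding half_space_def by clarsimp (meson le_less_trans neg_le_iff_le of_nat_mono)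

lemma ex_half_space: "\<exists>B. s \<in> half_space B"
proof -
  have "Re (partial_sum s i) > - real (nat \<lceil>\<Sum>i\<in>UNIV. \<bar>Re (partial_sum s i)\<bar>\<rceil> + 1)" for i
  proof -
    have "\<bar>Re (partial_sum s i)\<bar> \<le> (\<Sum>i\<in>UNIV. \<bar>Re (partial_sum s i)\<bar>)"
      by (rule member_le_sum) auto
    then show ?thesis by linarith
  qed
  then show ?thesis unfolding half_space_def by blast
qed

lemma mild_poles_subset: "mild_poles \<Lambda> F U \<Longrightarrow> U' \<subseteq> U \<Longrightarrow> mild_poles \<Lambda> F U'"
  unfolding mild_poles_def by blast

lemma L_domain_subset_half_space: "L_domain \<subseteq> half_space B"
  unfolding half_space_def L_domain_def
  by clarsimp (meson neg_le_0_iff_le le_less_trans of_nat_0_le_iff order.strict_trans1)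

lemma L_domain_subset_off:
  "(L_domain :: (complex ^ 'r::{finite,linorder}) set) \<subseteq> off_hyperplanes polar_forms"
proof -
  have "partial_sum s i \<noteq> of_int n" if "s \<in> L_domain" "polar_index i n" for s :: "complex ^ 'r::{finite,linorder}" and i n
  proof
    assume "partial_sum s i = of_int n"
    then have "real_of_int n > real (position i)"
      using that(1) by (auto simp: L_domain_def dest: spec[of _ i])
    then show False using that(2) by (auto simp: polar_index_def)
  qed
  then show ?thesis by (auto simp: off_hyperplanes_def polar_forms_eq)
qed

lemma partial_sum_axis:
  fixes s :: "complex ^ 'r::{finite,linorder}"
  assumes "\<And>i. i0 \<le> i"
  shows "partial_sum (s + t *s axis i0 1) i = partial_sum s i + t"
proof -
  have "(\<Sum>j\<in>{..i}. t * axis i0 1 $ j) = t"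
    using assms[of i] by (subst sum.mono_neutral_right[of _ "{i0}"]) (auto simp: axis_def)
  then show ?thesis by (simp add: partial_sum_def sum.distrib)
qed

lemma mild_poles_unique:
  fixes F G :: "complex ^ 'r::{finite,linorder} \<Rightarrow> complex"
  assumes F: "mild_poles polar_forms F (half_space B)" and G: "mild_poles polar_forms G (half_space B)"
    and FG: "\<And>s. s \<in> L_domain \<Longrightarrow> F s = G s" and s: "s \<in> half_space B" "s \<in> off_hyperplanes polar_forms"
  shows "F s = G s"
proof -
  define i0 :: 'r where "i0 = Min UNIV"
  have i0: "i0 \<le> i" for i unfolding i0_def by simp
  define p where "p t = s + t *s axis i0 1" for t
  have ps: "partial_sum (p t) i = partial_sum s i + t" for t i
    unfolding p_def by (rule partial_sum_axis[OF i0])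
  define S where "S = {t. p t \<in> half_space B}"
  define bad where "bad = {t. p t \<notin> off_hyperplanes polar_forms}"
  have S: "S = (\<Inter>i. {t. Re t > - real B - Re (partial_sum s i)})"
    by (auto simp: S_def half_space_def ps algebra_simps less_diff_eq)
  have conv: "convex S" unfolding S by (intro convex_INT convex_halfspace_Re_gt)
  have openS: "open S" unfolding S by (intro open_INT ballI open_halfspace_Re_gt) auto
  have "continuous_on UNIV p"
    unfolding p_def using has_derivative_line has_derivative_continuous
    by (intro continuous_at_imp_continuous_on) blast
  then have "open (p -` off_hyperplanes polar_forms)"
    using open_off_hyperplanes open_vimage by blast
  moreover have "S - bad = S \<inter> p -` off_hyperplanes polar_forms" by (auto simp: bad_def)
  ultimately have open_good: "open (S - bad)" using openS by auto
  \<comment> \<open>Along the line each partial sum takes each integer value once, so the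
    exceptional set is countable, and removing it from the open convex set \<open>S\<close> leaves a
    connected set.\<close>
  have "bad \<subseteq> (\<Union>i. range (\<lambda>n. of_int n - partial_sum s i))"
  proof
    fix t assume "t \<in> bad"
    then obtain i n where "partial_sum (p t) i = of_int n"
      by (auto simp: bad_def off_hyperplanes_def polar_forms_eq)
    then have "t = of_int n - partial_sum s i" by (simp add: ps algebra_simps)
    then show "t \<in> (\<Union>i. range (\<lambda>n. of_int n - partial_sum s i))" by blast
  qed
  then have "countable bad" by (rule countable_subset) auto
  then have conn: "connected (S - bad)"
    using openS conv by (intro connected_open_diff_countable) (auto intro: convex_connected)
  have holo: "(\<lambda>t. H (p t)) holomorphic_on (S - bad)" if "mild_poles polar_forms H (half_space B)" for H
    unfolding holomorphic_on_def
  proof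
    fix t assume "t \<in> S - bad"
    then have "cdiff H (p t)"
      using mild_poles_cdiff[OF that order.refl, of "p t"] by (auto simp: S_def bad_def)
    then show "(\<lambda>t. H (p t)) field_differentiable (at t within S - bad)"
      using cdiff_line field_differentiable_at_within unfolding p_def by blast
  qed
  \<comment> \<open>Beyond this real part every partial sum exceeds its position, so the line has
    entered the domain of the series.\<close>
  define c where "c = (\<Sum>i\<in>UNIV. \<bar>Re (partial_sum s i)\<bar> + real (position i))"
  have dom: "p t \<in> L_domain" if "Re t > c" for t
  proof -
    have "\<bar>Re (partial_sum s i)\<bar> + real (position i) \<le> c" for i
      unfolding c_def by (rule member_le_sum[where f = "\<lambda>i. \<bar>Re (partial_sum s i)\<bar> + real (position i)"]) auto
    then have "Re (partial_sum s i) + Re t > real (position i)" for i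
      using that by (smt (verit))
    then show ?thesis by (simp add: L_domain_def ps)
  qed
  have "F (p 0) = G (p 0)"
  proof (rule analytic_continuation_open[where f = "\<lambda>t. F (p t)" and g = "\<lambda>t. G (p t)"])
    show "open {t. Re t > c}" by (rule open_halfspace_Re_gt)
    show "open (S - bad)" by (rule open_good)
    show "connected (S - bad)" by (rule conn)
    have "complex_of_real (c + 1) \<in> {t. Re t > c}" by simp
    then show "{t. Re t > c} \<noteq> {}" by blast
    show "{t. Re t > c} \<subseteq> S - bad"
      using dom L_domain_subset_half_space L_domain_subset_off by (fastforce simp: S_def bad_def)
    show "(\<lambda>t. F (p t)) holomorphic_on (S - bad)" "(\<lambda>t. G (p t)) holomorphic_on (S - bad)"
      using holo F G by auto
    show "0 \<in> S - bad" using s by (simp add: S_def bad_def p_def)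
    show "F (p t) = G (p t)" if "t \<in> {t. Re t > c}" for t using FG dom that by simp
  qed
  then show ?thesis by (simp add: p_def)
qed

section \<open>From mild poles to the properties of the continuation\<close>

lemma mild_poles_imp_holomorphic:
  assumes "mild_poles polar_forms F UNIV"
  shows "holomorphic_several F (off_hyperplanes polar_forms)"
  using mild_poles_cdiff[OF assms order.refl] open_off_hyperplanes
  by (auto simp: holomorphic_several_iff)

lemma mild_poles_imp_simple_poles:
  assumes "mild_poles polar_forms F UNIV"
  shows "at_most_simple_poles_along F polar_forms"
  unfolding at_most_simple_poles_along_def holomorphic_several_iff
proof (intro allI conjI finite_vanishing_forms)
  fix a
  obtain V g where V: "open V" "a \<in> V" "\<And>s. s \<in> V \<Longrightarrow> cdiff g s"
    "\<And>s. s \<in> V \<Longrightarrow> s \<in> off_hyperplanes polar_forms \<Longrightarrow> F s * (\<Prod>l | l \<in> polar_forms \<and> l a = 0. l s) = g s"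
    using mild_polesE[OF assms UNIV_I] by blast
  show "\<exists>V g. a \<in> V \<and> (open V \<and> (\<forall>s\<in>V. cdiff g s)) \<and>
      (\<forall>s\<in>V \<inter> off_hyperplanes polar_forms. F s * (\<Prod>l | l \<in> polar_forms \<and> l a = 0. l s) = g s)"
    by (intro exI[of _ V] exI[of _ g]) (use V in auto)
qed

text \<open>The denominator is the product of the forms vanishing at \<open>a\<close>. Near
  \<open>a\<close> no other form vanishes, so a nonzero denominator places the point off all
  hyperplanes, where \<open>g\<close> is known to be the product of \<open>F\<close> and the
  denominator.\<close>

lemma mild_poles_imp_meromorphic:
  fixes F :: "complex ^ 'r::{finite,linorder} \<Rightarrow> complex"
  assumes "mild_poles polar_forms F UNIV"
  shows "meromorphic_several F UNIV"
  unfolding meromorphic_several_def holomorphic_several_iff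
proof (intro conjI ballI open_UNIV)
  fix a :: "complex ^ 'r::{finite,linorder}"
  obtain V g where V: "open V" "a \<in> V" "\<And>s. s \<in> V \<Longrightarrow> cdiff g s"
    "\<And>s. s \<in> V \<Longrightarrow> s \<in> off_hyperplanes polar_forms \<Longrightarrow> F s * (\<Prod>l | l \<in> polar_forms \<and> l a = 0. l s) = g s"
    using mild_polesE[OF assms UNIV_I] by blast
  define N where "N = {s. \<forall>l\<in>polar_forms. l a \<noteq> 0 \<longrightarrow> l s \<noteq> 0}"
  have "open (V \<inter> N)" "a \<in> V \<inter> N"
    using V open_nonvanishing_forms[of a] by (auto simp: N_def)
  then obtain e where e: "e > 0" "ball a e \<subseteq> V \<inter> N"
    using open_contains_ball by blast
  define h where "h s = (\<Prod>l | l \<in> polar_forms \<and> l a = 0. l s)" for s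
  define i0 :: 'r where "i0 = Min UNIV"
  have i0: "i0 \<le> i" for i unfolding i0_def by simp
  \<comment> \<open>This step raises every partial sum by \<open>e / 2\<close>, so all forms
    vanishing at \<open>a\<close> are nonzero at \<open>z\<close>.\<close>
  define z where "z = a + of_real (e / 2) *s axis i0 1"
  have "dist a z = e / 2"
    using e(1) by (simp add: z_def dist_norm norm_vector_smult)
  then have z: "z \<in> ball a e" using e(1) by simp
  have "l z \<noteq> 0" if "l \<in> polar_forms" "l a = 0" for l
    using that e(1) partial_sum_axis[OF i0, of a] by (auto simp: polar_forms_eq z_def)
  then have hz: "h z \<noteq> 0"
    unfolding h_def by (subst prod_zero_iff) (auto intro: finite_vanishing_forms)
  have quot: "F s = g s / h s" if s: "s \<in> ball a e" "h s \<noteq> 0" for s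
  proof -
    have "l s \<noteq> 0" if l: "l \<in> polar_forms" for l
    proof (cases "l a = 0")
      case True
      then show ?thesis
        using s(2) l finite_vanishing_forms[of a] unfolding h_def by (subst (asm) prod_zero_iff) auto
    next
      case False
      then show ?thesis using s(1) e(2) l by (auto simp: N_def)
    qed
    then have "F s * h s = g s"
      unfolding h_def using s(1) e(2) by (intro V(4)) (auto simp: off_hyperplanes_def)
    then show ?thesis using s(2) by (simp add: nonzero_eq_divide_eq)
  qed
  show "\<exists>V g h. a \<in> V \<and> V \<subseteq> UNIV \<and> connected V \<and> (open V \<and> (\<forall>a\<in>V. cdiff g a)) \<and>
      (open V \<and> (\<forall>a\<in>V. cdiff h a)) \<and> (\<exists>z\<in>V. h z \<noteq> 0) \<and> (\<forall>z\<in>V. h z \<noteq> 0 \<longrightarrow> F z = g z / h z)"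
  proof (rule exI[of _ "ball a e"], rule exI[of _ g], rule exI[of _ h], intro conjI ballI impI)
    show "cdiff h s" for s
      unfolding h_def by (rule cdiff_prod) (auto intro: cdiff_polar_form)
    show "\<exists>z\<in>ball a e. h z \<noteq> 0" using z hz by blast
  qed (use e V quot in auto)
qed

theorem theorem7p1:
  fixes chi :: "'r::{finite,linorder} \<Rightarrow> nat \<Rightarrow> complex" and q :: "'r \<Rightarrow> nat"
  assumes "\<And>i. dirichlet_character (q i) (chi i)"
  shows "(\<forall>s\<in>L_domain. L_term chi s summable_on decreasing_tuples) \<and>
    (\<exists>F :: complex ^ 'r::{finite,linorder} \<Rightarrow> complex.
       (\<forall>s\<in>L_domain. F s = multiple_L chi s) \<and>
       meromorphic_several F UNIV \<and>
       holomorphic_several F (off_hyperplanes polar_forms) \<and>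
       at_most_simple_poles_along F polar_forms)"
proof -
  \<comment> \<open>A common period for characters of different moduli.\<close>
  define Q where "Q = (\<Prod>i\<in>UNIV. q i)"
  have Q: "Q > 0" unfolding Q_def using assms by (intro prod_pos) (auto simp: dirichlet_character_def)
  have per: "periodic Q (chi i)" for i
  proof -
    have "chi i (n + k * q i) = chi i n" for n k
    proof (induction k)
      case (Suc k)
      have "chi i ((n + k * q i) + q i) = chi i (n + k * q i)"
        using assms[of i] by (simp only: dirichlet_character_def)
      with Suc show ?case by (simp add: algebra_simps)
    qed simp
    moreover have "Q = (\<Prod>j\<in>UNIV - {i}. q j) * q i"
      unfolding Q_def by (subst prod.remove[of _ i]) auto
    ultimately show ?thesis by (simp add: periodic_def)
  qed
  have "\<exists>M. \<forall>n. norm (chi i n) \<le> M" for i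
    using periodic_bounded[OF Q per] by metis
  then obtain Mi where Mi: "\<And>i n. norm (chi i n) \<le> Mi i" by metis
  define M where "M = Max (range Mi)"
  have chi: "norm (chi i n) \<le> M" for i n
    unfolding M_def by (rule order.trans[OF Mi Max_ge]) auto
  define i0 :: 'r where "i0 = Min UNIV"
  have i0: "i0 \<le> i" for i unfolding i0_def by simp
  define js where "js = sorted_list_of_set (UNIV - {i0})"
  have L: "sorted_wrt (<) (i0 # js)" "set (i0 # js) = UNIV"
    using i0 by (auto simp: js_def order.strict_iff_order)
  have tail: "tail_from i0 js" using L i0 by (auto simp: tail_from_def)
  have "{..i0} = {i0}" using i0 by (auto intro: antisym)
  then have pos: "position i0 = 1" and ps: "partial_sum s i0 = s $ i0" for s
    by (simp_all add: position_def partial_sum_def)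
  have conv: "conv (\<lambda>i. Re (s $ i)) (Re (s $ i0)) js" if "s \<in> L_domain" for s
    unfolding conv_tail_iff[OF tail] using that by (simp add: pos ps L_domain_def)
  note sums = multiple_L_eq_nested[where chi = chi, OF L chi conv]
  have ex: "\<exists>F. (\<forall>s\<in>L_domain. F s = multiple_L chi s) \<and> mild_poles polar_forms F (half_space B)" for B
  proof -
    \<comment> \<open>The outermost exponent is \<open>s $ i0\<close> itself, so the shift is
      \<open>c = 0\<close> and the first hyperplane is \<open>s $ i0 = 1\<close>.\<close>
    have "polar_index i0 (0 + 1)" by (simp add: polar_index_def pos)
    from nested_series_continuation[where chi = chi and B = B, OF Q per chi tail per this]
    obtain F where F: "\<And>s. conv (\<lambda>i. Re (s $ i)) (Re (partial_sum s i0 - of_int 0)) js \<Longrightarrow>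
              F s = nested_series_value chi js (chi i0) (partial_sum s i0 - of_int 0) s"
      "mild_poles (polar_forms_from i0) F (half_space B)" by blast
    have "F s = multiple_L chi s" if "s \<in> L_domain" for s
      using F(1)[of s] conv[OF that] sums(2)[OF that] by (simp add: ps)
    moreover have "polar_forms_from i0 = polar_forms"
      using i0 by (simp add: polar_forms_from_def polar_forms_eq)
    ultimately show ?thesis using F(2) by auto
  qed
  define P where "P B F \<longleftrightarrow> (\<forall>s\<in>L_domain. F s = multiple_L chi s) \<and> mild_poles polar_forms F (half_space B)" for B F
  have "\<exists>F. P B F" for B using ex unfolding P_def by blast
  then obtain FB where FB: "\<And>B. P B (FB B)" by metis
  \<comment> \<open>On \<open>L_domain\<close> every \<open>FB B\<close> is the series; in a half
    space, off the hyperplanes, the choices agree by \<open>mild_poles_unique\<close>. On the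
    hyperplanes the least \<open>B\<close> is merely a choice.\<close>
  define F where "F s = FB (LEAST B. s \<in> half_space B) s" for s
  have F_eq: "F s = FB B s" if s: "s \<in> half_space B" "s \<in> off_hyperplanes polar_forms" for s B
  proof -
    define B0 where "B0 = (LEAST B. s \<in> half_space B)"
    have s0: "s \<in> half_space B0" and le: "B0 \<le> B"
      unfolding B0_def using s(1) by (auto intro: LeastI Least_le)
    have "FB B0 s = FB B s"
    proof (rule mild_poles_unique[OF _ _ _ s0 s(2)])
      show "mild_poles polar_forms (FB B0) (half_space B0)" using FB[of B0] by (simp add: P_def)
      show "mild_poles polar_forms (FB B) (half_space B0)"
        by (rule mild_poles_subset[OF _ half_space_mono[OF le]]) (use FB[of B] in \<open>simp add: P_def\<close>)
      show "FB B0 u = FB B u" if "u \<in> L_domain" for u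
        using FB that by (simp add: P_def)
    qed
    then show ?thesis by (simp add: F_def B0_def)
  qed
  have mild: "mild_poles polar_forms F UNIV"
    unfolding mild_poles_def
  proof
    fix a :: "complex ^ 'r::{finite,linorder}"
    obtain B where a: "a \<in> half_space B" using ex_half_space by blast
    have "mild_poles polar_forms (FB B) (half_space B)" using FB[of B] by (simp add: P_def)
    then obtain V g where V: "open V" "a \<in> V" "\<And>s. s \<in> V \<Longrightarrow> cdiff g s"
      "\<And>s. s \<in> V \<Longrightarrow> s \<in> off_hyperplanes polar_forms \<Longrightarrow> FB B s * (\<Prod>l | l \<in> polar_forms \<and> l a = 0. l s) = g s"
      using mild_polesE[OF _ a] by blast
    show "\<exists>V g. open V \<and> a \<in> V \<and> (\<forall>s\<in>V. cdiff g s) \<and>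
      (\<forall>s\<in>V \<inter> off_hyperplanes polar_forms. F s * (\<Prod>l | l \<in> polar_forms \<and> l a = 0. l s) = g s)"
    proof (intro exI[of _ "V \<inter> half_space B"] exI[of _ g] conjI ballI)
      show "open (V \<inter> half_space B)" using V(1) open_half_space by blast
      fix s assume s: "s \<in> V \<inter> half_space B \<inter> off_hyperplanes polar_forms"
      then show "F s * (\<Prod>l | l \<in> polar_forms \<and> l a = 0. l s) = g s"
        using V(4)[of s] F_eq[of s B] by simp
    qed (use V a in auto)
  qed
  have "F s = multiple_L chi s" if "s \<in> L_domain" for s
    unfolding F_def using FB that by (simp add: P_def)
  with mild sums(1) show ?thesis
    using mild_poles_imp_holomorphic mild_poles_imp_meromorphic mild_poles_imp_simple_poles by blast
qed

end
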